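(* There exist absolute constants $c_1,c_2>0$ such that the following holds. Let $(\beta_1,\beta_2)\in\mathbb{R}^k\times\mathbb{R}^k$ be fixed (so not depending on the samples below), and let $\mathcal{S}$ be a set of samples from the noiseless mixed linear regression model with parameters $\beta_1^*,\beta_2^*$ and fractions $p_1,p_2$. Let $(\beta_1^+,\beta_2^+)$ be the output of one EM iteration started at $(\beta_1,\beta_2)$ and run on $\mathcal{S}$. If $$\max\{\|\beta_1-\beta_1^*\|_2,\|\beta_2-\beta_2^*\|_2\}\le\frac{c_1}{k^2}\|\beta_1^*-\beta_2^*\|_2\qquad\text{and}\qquad \frac{1}{\min\{p_1,p_2\}}\,k<|\mathcal{S}|<c_2k,$$ then, with probability greater than $1-\frac1k$ over the samples, $$\max\{\|\beta_1^+-\beta_1^*\|_2,\|\beta_2^+-\beta_2^*\|_2\}=0 .$$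
   Context: Noiseless mixed linear regression model: $\beta_1^*,\beta_2^*\in\mathbb{R}^k$ are distinct vectors with $\|\beta_1^*\|_2=\|\beta_2^*\|_2=1$. A sample set $\mathcal{S}$ consists of pairs $(y_i,\mathbf{x}_i)$, where the $\mathbf{x}_i\sim\mathcal{N}(0,I_k)$ are i.i.d. and $y_i=z_i\langle \mathbf{x}_i,\beta_1^*\rangle+(1-z_i)\langle\mathbf{x}_i,\beta_2^*\rangle$ with unobserved labels $z_i\in\{0,1\}$ not depending on the $\mathbf{x}_i$. The numbers $p_1,p_2>0$, $p_1+p_2=1$, are the fractions of samples in $\mathcal{S}$ that come from $\beta_1^*$ (those with $z_i=1$) and from $\beta_2^*$ (those with $z_i=0$) respectively. One EM iteration from $(\beta_1,\beta_2)$ on $\mathcal{S}$: set $J_1=\{i\in\mathcal{S}: |y_i-\langle\mathbf{x}_i,\beta_1\rangle|<|y_i-\langle\mathbf{x}_i,\beta_2\rangle|\}$ and $J_2=\mathcal{S}\setminus J_1$, and let $\beta_b^+\in\arg\min_{\beta\in\mathbb{R}^k}\sum_{i\in J_b}(y_i-\langle\mathbf{x}_i,\beta\rangle)^2$ for $b=1,2$. *)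

theory Defs
  imports "HOL-Probability.Probability"
begin

(* The dimension has to vary inside the statement (the constants do not depend on it), so R^k is
   the set of extensional functions on {..<k}; this is also the space of the product measures over
   {..<k}.  The Euclidean norm of v is then L2_set v {..<k}. *)
definition Rvec :: "nat \<Rightarrow> (nat \<Rightarrow> real) set" where
  "Rvec k = {..<k} \<rightarrow>\<^sub>E UNIV"

definition ip :: "nat \<Rightarrow> (nat \<Rightarrow> real) \<Rightarrow> (nat \<Rightarrow> real) \<Rightarrow> real" where
  "ip k u v = (\<Sum>j<k. u j * v j)"

definition vdist :: "nat \<Rightarrow> (nat \<Rightarrow> real) \<Rightarrow> (nat \<Rightarrow> real) \<Rightarrow> real" where
  "vdist k u v = L2_set (\<lambda>j. u j - v j) {..<k}"

(* N(0, I_k) *)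
definition std_gaussian :: "nat \<Rightarrow> (nat \<Rightarrow> real) measure" where
  "std_gaussian k = PiM {..<k} (\<lambda>_. density lborel std_normal_density)"

(* The law of n samples, as pairs (z, x) of labels and covariates: x 0, ..., x (n - 1) are
   i.i.d. N(0, I_k), and the labels have an arbitrary law Q and are independent of the covariates.
   Fixed labels z are the case Q = return_pmf z.  Only the labels z i with i < n are used. *)
definition sample_law ::
  "(nat \<Rightarrow> bool) pmf \<Rightarrow> nat \<Rightarrow> nat \<Rightarrow> ((nat \<Rightarrow> bool) \<times> (nat \<Rightarrow> nat \<Rightarrow> real)) measure" where
  "sample_law Q k n = measure_pmf Q \<Otimes>\<^sub>M PiM {..<n} (\<lambda>_. std_gaussian k)"

definition response ::
  "nat \<Rightarrow> (nat \<Rightarrow> real) \<Rightarrow> (nat \<Rightarrow> real) \<Rightarrow> (nat \<Rightarrow> bool) \<Rightarrow> (nat \<Rightarrow> nat \<Rightarrow> real) \<Rightarrow> nat \<Rightarrow> real" where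
  "response k \<beta>1s \<beta>2s z x i =
     of_bool (z i) * ip k (x i) \<beta>1s + (1 - of_bool (z i)) * ip k (x i) \<beta>2s"

definition em_J1 ::
  "nat \<Rightarrow> nat \<Rightarrow> (nat \<Rightarrow> real) \<Rightarrow> (nat \<Rightarrow> nat \<Rightarrow> real) \<Rightarrow> (nat \<Rightarrow> real) \<Rightarrow> (nat \<Rightarrow> real) \<Rightarrow> nat set" where
  "em_J1 k n y x \<beta>1 \<beta>2 =
     {i \<in> {..<n}. \<bar>y i - ip k (x i) \<beta>1\<bar> < \<bar>y i - ip k (x i) \<beta>2\<bar>}"

definition em_J2 ::
  "nat \<Rightarrow> nat \<Rightarrow> (nat \<Rightarrow> real) \<Rightarrow> (nat \<Rightarrow> nat \<Rightarrow> real) \<Rightarrow> (nat \<Rightarrow> real) \<Rightarrow> (nat \<Rightarrow> real) \<Rightarrow> nat set" where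
  "em_J2 k n y x \<beta>1 \<beta>2 = {..<n} - em_J1 k n y x \<beta>1 \<beta>2"

definition least_squares ::
  "nat \<Rightarrow> (nat \<Rightarrow> real) \<Rightarrow> (nat \<Rightarrow> nat \<Rightarrow> real) \<Rightarrow> nat set \<Rightarrow> (nat \<Rightarrow> real) \<Rightarrow> bool" where
  "least_squares k y x J b \<longleftrightarrow>
     is_arg_min (\<lambda>\<beta>. \<Sum>i\<in>J. (y i - ip k (x i) \<beta>)\<^sup>2) (\<lambda>\<beta>. \<beta> \<in> Rvec k) b"

(* A relation, because the least-squares minimizers need not be unique. *)
definition em_output ::
  "nat \<Rightarrow> nat \<Rightarrow> (nat \<Rightarrow> real) \<Rightarrow> (nat \<Rightarrow> nat \<Rightarrow> real) \<Rightarrow> (nat \<Rightarrow> real) \<Rightarrow> (nat \<Rightarrow> real)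
     \<Rightarrow> (nat \<Rightarrow> real) \<Rightarrow> (nat \<Rightarrow> real) \<Rightarrow> bool" where
  "em_output k n y x \<beta>1 \<beta>2 \<beta>1p \<beta>2p \<longleftrightarrow>
     least_squares k y x (em_J1 k n y x \<beta>1 \<beta>2) \<beta>1p \<and>
     least_squares k y x (em_J2 k n y x \<beta>1 \<beta>2) \<beta>2p"

end

theory Submission
  imports Defs
begin

text \<open>
  Sample \<open>i\<close> is misclassified only if \<open>\<bar>\<langle>x\<^sub>i, v\<rangle>\<bar> \<le> \<bar>\<langle>x\<^sub>i, u\<rangle>\<bar>\<close>, where \<open>u\<close> is the error of the iterate for the
  label of \<open>i\<close> and \<open>v\<close> is the difference between the true vector and the other iterate, so that
  \<open>\<bar>u\<bar> / \<bar>v\<bar> = O(c\<^sub>1 / k\<^sup>2)\<close>. For Gaussian \<open>x\<close> this has probability \<open>O(\<bar>u\<bar> / \<bar>v\<bar>)\<close>, and a union bound over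
  \<open>n < 3 k\<close> samples makes all classifications correct with probability at least \<open>1 - 1 / (2 k)\<close>.
  Both classes contain at least \<open>k\<close> Gaussian covariates, which span almost surely; on correctly
  classified noiseless data the true vectors are then the unique least-squares minimizers.

  The ratio bound must be linear in \<open>\<bar>u\<bar> / \<bar>v\<bar>\<close>: separate bounds for \<open>\<langle>x, u\<rangle>\<close> and \<open>\<langle>x, v\<rangle>\<close> would lose
  a factor \<open>sqrt (ln k)\<close>. Independence is avoided by slicing according to the size of \<open>\<langle>x, u\<rangle>\<close> and
  bounding the indicator of each slice by an exponential, which only shifts the Gaussian
  (Cameron-Martin), while \<open>\<langle>x, v\<rangle>\<close> still has density at most \<open>1 / (2 \<bar>v\<bar>)\<close>.
\<close>

section \<open>Strips and cones under the Gaussian measure\<close>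

lemma prob_space_std_normal: "prob_space (density lborel std_normal_density)"
  using prob_space_normal_density[of 1 0] by simp

text \<open>Finite-dimensional Cameron-Martin: the tilt factorizes over the coordinates, and
  completing the square, a t - a^2/2 - t^2/2 = -(t - a)^2/2, turns each factor into the density of
  N(a, 1). Agreement on boxes determines the product measure.\<close>

lemma density_PiM_std_normal_tilt:
  fixes a :: "'i \<Rightarrow> real"
  assumes I: "finite I"
  shows "density (PiM I (\<lambda>_. density lborel std_normal_density))
           (\<lambda>x. ennreal (exp (\<Sum>j\<in>I. a j * x j - (a j)\<^sup>2 / 2)))
         = PiM I (\<lambda>j. density lborel (normal_density (a j) 1))" (is "?L = ?R")
proof -
  let ?N = "\<lambda>_::'i. density lborel std_normal_density"
  let ?Na = "\<lambda>j. density lborel (normal_density (a j) 1)"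
  interpret N: product_sigma_finite ?N
    by (simp add: product_sigma_finite_def prob_space_std_normal prob_space_imp_sigma_finite)
  interpret Na: product_sigma_finite ?Na
    by (simp add: product_sigma_finite_def prob_space_normal_density prob_space_imp_sigma_finite)
  show ?thesis
  proof (rule Na.PiM_eqI[OF I])
    show "sets ?L = sets ?R"
      by (auto intro!: sets_PiM_cong)
    fix A assume A: "\<And>i. i \<in> I \<Longrightarrow> A i \<in> sets (?Na i)"
    then have A': "\<And>i. i \<in> I \<Longrightarrow> A i \<in> sets borel" by simp
    \<comment> \<open>\<open>x\<close> has to lie in the space: membership in the box also demands
      extensionality off \<open>I\<close>, which the coordinate indicators cannot see.\<close>
    have *: "ennreal (exp (\<Sum>j\<in>I. a j * x j - (a j)\<^sup>2 / 2)) * indicator (Pi\<^sub>E I A) x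
        = (\<Prod>j\<in>I. ennreal (exp (a j * x j - (a j)\<^sup>2 / 2)) * indicator (A j) (x j))"
      if "x \<in> space (PiM I ?N)" for x
    proof -
      have "indicator (Pi\<^sub>E I A) x = (\<Prod>j\<in>I. indicator (A j) (x j) :: ennreal)"
      proof (cases "\<forall>j\<in>I. x j \<in> A j")
        case True
        then show ?thesis using that by (auto simp: space_PiM PiE_def)
      next
        case False
        then obtain j where "j \<in> I" "x j \<notin> A j" by auto
        moreover from this have "(\<Prod>j\<in>I. indicator (A j) (x j) :: ennreal) = 0"
          using I by (intro prod_zero bexI[of _ j]) auto
        moreover have "x \<notin> Pi\<^sub>E I A" using \<open>j \<in> I\<close> \<open>x j \<notin> A j\<close> by auto
        ultimately show ?thesis by simp
      qed
      then show ?thesis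
        by (simp add: prod.distrib exp_sum I prod_ennreal)
    qed
    have "emeasure ?L (Pi\<^sub>E I A) =
        (\<integral>\<^sup>+x. ennreal (exp (\<Sum>j\<in>I. a j * x j - (a j)\<^sup>2 / 2)) * indicator (Pi\<^sub>E I A) x \<partial>PiM I ?N)"
      by (subst emeasure_density) (auto intro!: sets_PiM_I_finite I A')
    also have "\<dots> = (\<integral>\<^sup>+x. (\<Prod>j\<in>I. ennreal (exp (a j * x j - (a j)\<^sup>2 / 2)) * indicator (A j) (x j)) \<partial>PiM I ?N)"
      by (intro nn_integral_cong *)
    also have "\<dots> = (\<Prod>j\<in>I. \<integral>\<^sup>+t. ennreal (exp (a j * t - (a j)\<^sup>2 / 2)) * indicator (A j) t \<partial>?N j)"
      using A' by (intro N.product_nn_integral_prod I) auto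
    also have "\<dots> = (\<Prod>j\<in>I. emeasure (?Na j) (A j))"
    proof (rule prod.cong[OF refl])
      fix j assume j: "j \<in> I"
      have [measurable]: "A j \<in> sets borel" using A' j .
      have eq: "std_normal_density t * exp (a j * t - (a j)\<^sup>2 / 2) = normal_density (a j) 1 t" for t
        unfolding normal_density_def
        by (simp add: exp_add[symmetric] power2_eq_square field_simps)
      show "(\<integral>\<^sup>+t. ennreal (exp (a j * t - (a j)\<^sup>2 / 2)) * indicator (A j) t \<partial>?N j) = emeasure (?Na j) (A j)"
        by (subst nn_integral_density)
           (auto simp: emeasure_density eq[symmetric] ennreal_mult mult_ac intro!: nn_integral_cong)
    qed
    finally show "emeasure ?L (Pi\<^sub>E I A) = (\<Prod>j\<in>I. emeasure (?Na j) (A j))" .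
  qed
qed

text \<open>As sqrt(2 pi) is at least 2, the density is at most 1 / (2 \<sigma>) wherever its mean
  lies, and the interval has length 2 s. Uniformity in the mean is what allows the Gaussian to be
  shifted later.\<close>

lemma emeasure_normal_interval_le:
  assumes "0 < \<sigma>" "0 \<le> s"
  shows "emeasure (density lborel (normal_density \<mu> \<sigma>)) {-s..s} \<le> ennreal (s / \<sigma>)"
proof -
  have "2\<^sup>2 \<le> 2 * pi" using pi_gt3 by simp
  then have 2: "2 \<le> sqrt (2 * pi)" using real_le_rsqrt by blast
  have le: "normal_density \<mu> \<sigma> x \<le> 1 / (2 * \<sigma>)" for x
  proof -
    have "normal_density \<mu> \<sigma> x \<le> 1 / sqrt (2 * pi * \<sigma>\<^sup>2)"
      unfolding normal_density_def using assms by (simp add: field_simps)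
    also have "\<dots> = 1 / (sqrt (2 * pi) * \<sigma>)" using assms by (simp add: real_sqrt_mult)
    also have "\<dots> \<le> 1 / (2 * \<sigma>)" using assms 2 by (intro divide_left_mono mult_right_mono) auto
    finally show ?thesis .
  qed
  have "emeasure (density lborel (normal_density \<mu> \<sigma>)) {-s..s}
      = (\<integral>\<^sup>+x. ennreal (normal_density \<mu> \<sigma> x) * indicator {-s..s} x \<partial>lborel)"
    by (subst emeasure_density) auto
  also have "\<dots> \<le> (\<integral>\<^sup>+x. ennreal (1 / (2 * \<sigma>)) * indicator {-s..s} x \<partial>lborel)"
    using le by (intro nn_integral_mono mult_right_mono ennreal_leI) auto
  also have "\<dots> = ennreal (s / \<sigma>)"
    using assms by (subst nn_integral_cmult_indicator) (auto simp: ennreal_mult'[symmetric])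
  finally show ?thesis .
qed

text \<open>As a sum of independent scaled coordinates, the linear form is again Gaussian, with
  standard deviation \<open>L2_set v I\<close>; its mean depends on \<open>a\<close>, but the
  interval bound does not.\<close>

lemma emeasure_PiM_normal_strip_le:
  fixes a v :: "'i \<Rightarrow> real"
  assumes I: "finite I" and v: "0 < L2_set v I" and s: "0 \<le> s"
  shows "emeasure (PiM I (\<lambda>j. density lborel (normal_density (a j) 1)))
           {x \<in> space (PiM I (\<lambda>j. density lborel (normal_density (a j) 1))). \<bar>\<Sum>j\<in>I. v j * x j\<bar> \<le> s}
         \<le> ennreal (s / L2_set v I)"
proof -
  let ?Na = "\<lambda>j. density lborel (normal_density (a j) 1)"
  let ?M = "PiM I ?Na"
  \<comment> \<open>Coordinates with coefficient 0 are dropped: their scaled versions are degenerate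
    and have no normal density.\<close>
  let ?J = "{j\<in>I. v j \<noteq> 0}"
  interpret M: prob_space ?M
    by (intro prob_space_PiM prob_space_normal_density) simp
  have "?J \<noteq> {}"
  proof
    assume "?J = {}"
    then have "L2_set v I = 0" using I by (auto simp: L2_set_eq_0_iff)
    with v show False by simp
  qed
  then have Ine: "I \<noteq> {}" by auto
  have rv: "(\<lambda>x. x j) \<in> measurable ?M borel" if "j \<in> I" for j
    using measurable_component_singleton[OF that, of ?Na] by (simp cong: measurable_cong_sets)
  have dist: "distr ?M (?Na j) (\<lambda>x. x j) = ?Na j" if "j \<in> I" for j
    using that by (intro distr_PiM_component prob_space_normal_density) auto
  have dist': "distr ?M borel (\<lambda>x. x j) = ?Na j" if "j \<in> I" for j
    using dist[OF that] by (simp only: distr_cong[OF refl _ refl, of borel "?Na j"] sets_density sets_lborel)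
  \<comment> \<open>The coordinates are independent because their joint law, that of the identity
    map, is the product of its marginals.\<close>
  have indep: "M.indep_vars (\<lambda>_. borel) (\<lambda>j x. x j) I"
  proof (subst M.indep_vars_iff_distr_eq_PiM'[OF Ine rv])
    have "distr ?M (PiM I (\<lambda>_. borel)) (\<lambda>x. \<lambda>i\<in>I. x i) = distr ?M ?M (\<lambda>x. x)"
    proof (rule distr_cong)
      show "sets (PiM I (\<lambda>_. borel)) = sets ?M" by (intro sets_PiM_cong) auto
      show "(\<lambda>i\<in>I. x i) = x" if "x \<in> space ?M" for x
        using that by (auto simp: space_PiM PiE_def extensional_restrict)
    qed simp
    also have "\<dots> = ?M" by (rule distr_id)
    also have "\<dots> = PiM I (\<lambda>j. distr ?M borel (\<lambda>x. x j))"
      by (intro PiM_cong refl) (simp only: dist')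
    finally show "distr ?M (PiM I (\<lambda>_. borel)) (\<lambda>x. \<lambda>i\<in>I. x i) = PiM I (\<lambda>i. distr ?M borel (\<lambda>x. x i))" .
  qed
  have indep': "M.indep_vars (\<lambda>_. borel) (\<lambda>j x. v j * x j) ?J"
    using M.indep_vars_compose2[OF M.indep_vars_subset[OF indep, of ?J], of "\<lambda>j t. v j * t" "\<lambda>_. borel"]
    by simp
  have d1: "distributed ?M lborel (\<lambda>x. x j) (normal_density (a j) 1)" if "j \<in> I" for j
    unfolding distributed_def using rv[OF that] dist[OF that] dist'[OF that]
    by (auto simp: distr_cong[OF refl sets_lborel refl])
  have "distributed ?M lborel (\<lambda>x. v j * x j) (normal_density (v j * a j) \<bar>v j\<bar>)" if "j \<in> ?J" for j
    using M.normal_density_affine[OF d1, of j "v j" 0] that by simp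
  then have D: "distributed ?M lborel (\<lambda>x. \<Sum>j\<in>?J. v j * x j)
      (normal_density (\<Sum>j\<in>?J. v j * a j) (sqrt (\<Sum>j\<in>?J. \<bar>v j\<bar>\<^sup>2)))"
    using I \<open>?J \<noteq> {}\<close> by (intro M.sum_indep_normal indep') auto
  have sumJ: "(\<Sum>j\<in>?J. v j * x j) = (\<Sum>j\<in>I. v j * x j)" for x :: "'i \<Rightarrow> real"
    using I by (intro sum.mono_neutral_left) auto
  have sqJ: "sqrt (\<Sum>j\<in>?J. \<bar>v j\<bar>\<^sup>2) = L2_set v I"
    unfolding L2_set_def using I by (auto intro!: sum.mono_neutral_left arg_cong[where f=sqrt])
  let ?\<mu> = "\<Sum>j\<in>?J. v j * a j"
  have D: "distributed ?M lborel (\<lambda>x. \<Sum>j\<in>I. v j * x j) (normal_density ?\<mu> (L2_set v I))"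
    using D unfolding sumJ sqJ .
  have "{x \<in> space ?M. \<bar>\<Sum>j\<in>I. v j * x j\<bar> \<le> s} = (\<lambda>x. \<Sum>j\<in>I. v j * x j) -` {-s..s} \<inter> space ?M"
    by auto
  also have "emeasure ?M \<dots> = emeasure (density lborel (normal_density ?\<mu> (L2_set v I))) {-s..s}"
    using D unfolding distributed_def by (subst emeasure_distr[symmetric, where N = lborel]) auto
  also have "\<dots> \<le> ennreal (s / L2_set v I)"
    using v s by (rule emeasure_normal_interval_le)
  finally show ?thesis .
qed

lemma borel_measurable_linear_PiM:
  "(\<lambda>x. \<Sum>j\<in>I. u j * x j) \<in> borel_measurable (PiM I (\<lambda>_. density lborel std_normal_density))"
proof (intro borel_measurable_sum borel_measurable_times borel_measurable_const)
  fix j assume "j \<in> I"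
  from measurable_component_singleton[OF this, of "\<lambda>_. density lborel std_normal_density"]
  show "(\<lambda>x. x j) \<in> borel_measurable (PiM I (\<lambda>_. density lborel std_normal_density))"
    by (simp add: measurable_def)
qed

text \<open>Up to the constant exp(|u|^2 / 2), which is at most exp(1/2) and hence at most 2, the
  exponential is a Cameron-Martin density. What remains is the mass of the strip under a shifted
  Gaussian, at most s / w.\<close>

lemma nn_integral_exp_strip_le:
  fixes u v :: "'i \<Rightarrow> real"
  defines "M \<equiv> \<lambda>I. PiM I (\<lambda>_. density lborel std_normal_density)"
  assumes I: "finite I" and u: "L2_set u I \<le> 1" and w: "0 < w" "w \<le> L2_set v I" and s: "0 \<le> s"
  shows "(\<integral>\<^sup>+x. ennreal (exp (\<Sum>j\<in>I. u j * x j)) * indicator {x. \<bar>\<Sum>j\<in>I. v j * x j\<bar> \<le> s} x \<partial>M I)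
         \<le> ennreal (2 * (s / w))"
proof -
  let ?N = "\<lambda>_. density lborel std_normal_density"
  let ?Mu = "PiM I (\<lambda>j. density lborel (normal_density (u j) 1))"
  let ?S = "{x. \<bar>\<Sum>j\<in>I. v j * x j\<bar> \<le> s}"
  have [measurable]: "(\<lambda>x. \<Sum>j\<in>I. c j * x j) \<in> borel_measurable (M I)" for c
    unfolding M_def by (rule borel_measurable_linear_PiM)
  have sp: "space ?Mu = space (M I)" by (simp add: M_def space_PiM)
  have S: "{x \<in> space (M I). \<bar>\<Sum>j\<in>I. v j * x j\<bar> \<le> s} \<in> sets (M I)" by measurable
  define c where "c = (\<Sum>j\<in>I. (u j)\<^sup>2 / 2)"
  have "c = (L2_set u I)\<^sup>2 / 2" unfolding c_def L2_set_def by (simp add: sum_divide_distrib sum_nonneg)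
  also have "\<dots> \<le> 1\<^sup>2 / 2" using u by (intro divide_right_mono power_mono) auto
  finally have c: "c \<le> 1/2" by simp
  have e2: "exp c \<le> 2"
  proof -
    have "exp (1/2::real) \<le> 1 + 1/2 + (1/2)\<^sup>2" by (rule exp_bound) auto
    also have "\<dots> \<le> 2" by (simp add: power2_eq_square)
    finally have "exp (1/2::real) \<le> 2" .
    moreover have "exp c \<le> exp (1/2)" using c by simp
    ultimately show ?thesis by linarith
  qed
  let ?g = "\<lambda>x. ennreal (exp (\<Sum>j\<in>I. u j * x j - (u j)\<^sup>2 / 2))"
  let ?S' = "{x \<in> space (M I). \<bar>\<Sum>j\<in>I. v j * x j\<bar> \<le> s}"
  have g: "?g = (\<lambda>x. ennreal (exp ((\<Sum>j\<in>I. u j * x j) - c)))"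
    by (simp add: c_def sum_subtractf)
  have gm: "?g \<in> borel_measurable (M I)"
    unfolding g by measurable
  have "(\<integral>\<^sup>+x. ennreal (exp (\<Sum>j\<in>I. u j * x j)) * indicator ?S x \<partial>M I)
      = (\<integral>\<^sup>+x. ennreal (exp c) * (?g x * indicator ?S' x) \<partial>M I)"
    by (intro nn_integral_cong)
       (auto simp: indicator_def ennreal_mult'[symmetric] exp_add[symmetric] c_def sum_subtractf)
  also have "\<dots> = ennreal (exp c) * (\<integral>\<^sup>+x. ?g x * indicator ?S' x \<partial>M I)"
    by (intro nn_integral_cmult borel_measurable_times_ennreal borel_measurable_indicator gm S)
  also have "(\<integral>\<^sup>+x. ?g x * indicator ?S' x \<partial>M I) = emeasure (density (M I) ?g) ?S'"
    by (intro emeasure_density[symmetric] gm S)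
  also have "\<dots> = emeasure ?Mu {x \<in> space ?Mu. \<bar>\<Sum>j\<in>I. v j * x j\<bar> \<le> s}"
    unfolding M_def density_PiM_std_normal_tilt[OF I] by (simp add: space_PiM)
  also have "ennreal (exp c) * \<dots> \<le> ennreal (exp c) * ennreal (s / L2_set v I)"
    using w s by (intro mult_left_mono emeasure_PiM_normal_strip_le I) auto
  also have "\<dots> \<le> ennreal 2 * ennreal (s / w)"
    using e2 w s by (intro mult_mono ennreal_leI divide_left_mono) auto
  also have "\<dots> = ennreal (2 * (s / w))"
    using s w by (subst ennreal_mult) auto
  finally show ?thesis .
qed

text \<open>On slice \<open>m\<close> each of two signed tilts contributes 2 (m + 1) \<eta> / w,
  damped by exp(-m). Summing 4 (\<eta> / w) (m + 1) / 2^m over all slices gives the constant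
  16.\<close>

lemma emeasure_std_gaussian_ratio_le:
  fixes u v :: "'i \<Rightarrow> real"
  defines "M \<equiv> \<lambda>I. PiM I (\<lambda>_. density lborel std_normal_density)"
  assumes I: "finite I" and \<eta>: "0 < \<eta>" "L2_set u I \<le> \<eta>" and w: "0 < w" "w \<le> L2_set v I"
  shows "emeasure (M I) {x \<in> space (M I). \<bar>\<Sum>j\<in>I. v j * x j\<bar> \<le> \<bar>\<Sum>j\<in>I. u j * x j\<bar>} \<le> ennreal (16 * (\<eta> / w))"
proof -
  let ?N = "\<lambda>_. density lborel std_normal_density"
  have [measurable]: "(\<lambda>x. \<Sum>j\<in>I. c j * x j) \<in> borel_measurable (M I)" for c
    unfolding M_def by (rule borel_measurable_linear_PiM)
  let ?U = "\<lambda>x. \<Sum>j\<in>I. u j * x j" and ?V = "\<lambda>x. \<Sum>j\<in>I. v j * x j"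
  \<comment> \<open>Slice \<open>m\<close> keeps a lower bound on the form in \<open>u\<close> and
    the upper bound that the form in \<open>v\<close> inherits. The slices may overlap;
    subadditivity is enough.\<close>
  define E where "E m = {x \<in> space (M I). real m * \<eta> \<le> \<bar>?U x\<bar> \<and> \<bar>?V x\<bar> \<le> (real m + 1) * \<eta>}" for m
  have E[measurable]: "E m \<in> sets (M I)" for m unfolding E_def by measurable
  have sub: "{x \<in> space (M I). \<bar>?V x\<bar> \<le> \<bar>?U x\<bar>} \<subseteq> (\<Union>m. E m)"
  proof
    fix x assume x: "x \<in> {x \<in> space (M I). \<bar>?V x\<bar> \<le> \<bar>?U x\<bar>}"
    define m where "m = nat \<lfloor>\<bar>?U x\<bar> / \<eta>\<rfloor>"
    have "0 \<le> \<bar>?U x\<bar> / \<eta>" using \<eta> by simp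
    then have "real m = of_int \<lfloor>\<bar>?U x\<bar> / \<eta>\<rfloor>" unfolding m_def by simp
    then have "real m \<le> \<bar>?U x\<bar> / \<eta>" "\<bar>?U x\<bar> / \<eta> \<le> real m + 1"
      using real_of_int_floor_add_one_ge by auto
    then have "real m * \<eta> \<le> \<bar>?U x\<bar>" "\<bar>?U x\<bar> \<le> (real m + 1) * \<eta>"
      using \<eta> by (simp_all add: pos_le_divide_eq pos_divide_le_eq)
    with x have "x \<in> E m" by (auto simp: E_def)
    then show "x \<in> (\<Union>m. E m)" by blast
  qed
  have bound: "emeasure (M I) (E m) \<le> ennreal (4 * (\<eta> / w) * (real (Suc m) * (1/2)^m))" for m
  proof -
    let ?s = "(real m + 1) * \<eta>"
    \<comment> \<open>Dividing by \<open>\<eta>\<close> makes the tilt vector have norm at most 1.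
      Both signs occur because a lower bound on the absolute value of the form in \<open>u\<close>
      bounds only the form or its negative from below.\<close>
    let ?F = "\<lambda>\<epsilon> x. ennreal (exp (\<Sum>j\<in>I. \<epsilon> * u j / \<eta> * x j)) * indicator {x. \<bar>?V x\<bar> \<le> ?s} x"
    have F: "integral\<^sup>N (M I) (?F \<epsilon>) \<le> ennreal (2 * (?s / w))" if "\<bar>\<epsilon>\<bar> = 1" for \<epsilon>
      unfolding M_def
    proof (rule nn_integral_exp_strip_le[OF I _ w])
      have "L2_set (\<lambda>j. \<epsilon> * u j / \<eta>) I = L2_set (\<lambda>j. u j * (\<epsilon> / \<eta>)) I" by (simp add: mult_ac)
      also have "\<dots> = L2_set u I * \<bar>\<epsilon> / \<eta>\<bar>"
        unfolding L2_set_def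
        by (simp only: power_mult_distrib sum_distrib_right[symmetric] real_sqrt_mult real_sqrt_abs)
      also have "\<dots> \<le> 1" using \<eta> that by (simp add: abs_div)
      finally show "L2_set (\<lambda>j. \<epsilon> * u j / \<eta>) I \<le> 1" .
      show "0 \<le> ?s" using \<eta> by simp
    qed
    \<comment> \<open>Since exp(-1) is at most 1/2, the decay can be taken geometric, with an
      explicit sum.\<close>
    have exp_half: "exp (- real m) \<le> (1/2)^m"
    proof -
      have "exp (-1::real) \<le> 1/2" using exp_ge_add_one_self[of "1::real"] by (simp add: exp_minus field_simps)
      then have "exp (-1::real) ^ m \<le> (1/2)^m" by (intro power_mono) auto
      then show ?thesis by (simp add: exp_of_nat_mult[symmetric])
    qed
    have "emeasure (M I) (E m) = (\<integral>\<^sup>+x. indicator (E m) x \<partial>M I)" by simp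
    also have "\<dots> \<le> (\<integral>\<^sup>+x. ennreal (exp (- real m)) * (?F 1 x + ?F (-1) x) \<partial>M I)"
    proof (intro nn_integral_mono)
      fix x assume "x \<in> space (M I)"
      show "indicator (E m) x \<le> ennreal (exp (- real m)) * (?F 1 x + ?F (-1) x)"
      proof (cases "x \<in> E m")
        case True
        have U: "(\<Sum>j\<in>I. \<epsilon> * u j / \<eta> * x j) = \<epsilon> * ?U x / \<eta>" for \<epsilon>
          by (simp add: sum_distrib_left sum_divide_distrib mult_ac)
        have "real m \<le> \<bar>?U x\<bar> / \<eta>" using True \<eta> by (simp add: E_def pos_le_divide_eq)
        then have "exp (real m) \<le> exp (?U x / \<eta>) \<or> exp (real m) \<le> exp (- ?U x / \<eta>)"
          by (auto simp: abs_if split: if_splits)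
        then have "exp (real m) \<le> exp (?U x / \<eta>) + exp (- ?U x / \<eta>)"
          using exp_gt_zero[of "?U x / \<eta>"] exp_gt_zero[of "- ?U x / \<eta>"] by linarith
        then have "exp (- real m) * exp (real m) \<le> exp (- real m) * (exp (?U x / \<eta>) + exp (- ?U x / \<eta>))"
          by (intro mult_left_mono) auto
        then have "1 \<le> exp (- real m) * (exp (?U x / \<eta>) + exp (- ?U x / \<eta>))"
          by (simp add: exp_minus)
        then have "ennreal 1 \<le> ennreal (exp (- real m) * (exp (?U x / \<eta>) + exp (- ?U x / \<eta>)))"
          by (rule ennreal_leI)
        also have "\<dots> = ennreal (exp (- real m)) * (ennreal (exp (?U x / \<eta>)) + ennreal (exp (- ?U x / \<eta>)))"
          by (simp add: ennreal_mult)
        finally show ?thesis using True unfolding U by (simp add: E_def)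
      qed simp
    qed
    also have "\<dots> = ennreal (exp (- real m)) * (integral\<^sup>N (M I) (?F 1) + integral\<^sup>N (M I) (?F (-1)))"
    proof -
      have Fm: "?F \<epsilon> \<in> borel_measurable (M I)" for \<epsilon>
      proof -
        have "(\<lambda>x. ennreal (exp (\<Sum>j\<in>I. \<epsilon> * u j / \<eta> * x j)) * indicator {x \<in> space (M I). \<bar>?V x\<bar> \<le> ?s} x)
            \<in> borel_measurable (M I)" by measurable
        then show ?thesis by (rule measurable_cong[THEN iffD1, rotated]) (simp add: indicator_def)
      qed
      show ?thesis by (simp only: nn_integral_cmult[OF borel_measurable_add[OF Fm Fm]] nn_integral_add[OF Fm Fm])
    qed
    also have "\<dots> \<le> ennreal ((1/2)^m) * (ennreal (2 * (?s / w)) + ennreal (2 * (?s / w)))"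
      by (intro mult_mono add_mono F ennreal_leI exp_half) auto
    also have "\<dots> = ennreal (4 * (\<eta> / w) * (real (Suc m) * (1/2)^m))"
      using \<eta> w by (simp add: ennreal_mult'[symmetric] ennreal_plus[symmetric] field_simps del: ennreal_plus)
    finally show ?thesis .
  qed
  \<comment> \<open>The series of (m + 1) t^m sums to 1 / (1 - t)^2, which is 4 at t = 1/2.\<close>
  have sums: "(\<lambda>m. 4 * (\<eta> / w) * (real (Suc m) * (1/2)^m)) sums (4 * (\<eta> / w) * 4)"
    using sums_mult[OF geometric_deriv_sums[of "1/2::real"], of "4 * (\<eta> / w)"] by (simp add: power2_eq_square)
  have "emeasure (M I) {x \<in> space (M I). \<bar>?V x\<bar> \<le> \<bar>?U x\<bar>} \<le> emeasure (M I) (\<Union>m. E m)"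
    by (intro emeasure_mono sub) auto
  also have "\<dots> \<le> (\<Sum>m. emeasure (M I) (E m))"
    by (intro emeasure_subadditive_countably) auto
  also have "\<dots> \<le> (\<Sum>m. ennreal (4 * (\<eta> / w) * (real (Suc m) * (1/2)^m)))"
    by (intro suminf_le bound) auto
  also have "\<dots> = ennreal (4 * (\<eta> / w) * 4)"
    using sums \<eta> w by (intro sums_unique[symmetric] sums_ennreal[THEN iffD2]) auto
  finally show ?thesis by simp
qed

section \<open>Least squares\<close>

lemma countable_PiE_Rats: "countable ({..<k::nat} \<rightarrow>\<^sub>E (\<rat> :: real set))"
  by (intro countable_PiE countable_rat) auto

lemma real_rat_sequence:
  fixes b :: real
  obtains r where "\<And>m. r m \<in> \<rat>" "r \<longlonglongrightarrow> b"
proof -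
  have "\<exists>q\<in>\<rat>. b < q \<and> q < b + 1 / real (Suc m)" for m
    by (intro Rats_dense_in_real) simp
  then obtain r where r: "\<And>m. r m \<in> \<rat>" "\<And>m. b < r m" "\<And>m. r m < b + 1 / real (Suc m)" by metis
  have "r \<longlonglongrightarrow> b"
  proof (rule tendsto_sandwich[OF _ _ tendsto_const])
    have "(\<lambda>m. b + 1 / real (Suc m)) \<longlonglongrightarrow> b + 0"
      by (intro tendsto_add tendsto_const LIMSEQ_Suc[OF lim_1_over_n])
    then show "(\<lambda>m. b + 1 / real (Suc m)) \<longlonglongrightarrow> b" by simp
    show "\<forall>\<^sub>F m in sequentially. r m \<le> b + 1 / real (Suc m)"
      by (intro always_eventually allI less_imp_le r)
  qed (use r in \<open>auto intro: less_imp_le always_eventually\<close>)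
  with r show thesis using that by blast
qed

text \<open>Extensional functions are pinned to \<open>undefined\<close> off \<open>{..<k}\<close>,
  so the sphere is a closed subset of a product of intervals and singletons, which is compact by
  Tychonoff.\<close>

lemma compact_unit_sphere_PiE:
  "compact {v \<in> {..<k::nat} \<rightarrow>\<^sub>E (UNIV :: real set). (\<Sum>j<k. (v j)\<^sup>2) = 1}" (is "compact ?K")
proof -
  let ?B = "PiE UNIV (\<lambda>j. if j < k then {-1..1::real} else {undefined})"
  have "compactin (product_topology (\<lambda>_. euclidean) UNIV) ?B"
    unfolding compactin_PiE by simp
  then have B: "compact ?B"
    unfolding euclidean_product_topology compactin_euclidean_iff .
  have "closed {v :: nat \<Rightarrow> real. (\<Sum>j<k. (v j)\<^sup>2) = 1}"
    by (intro closed_Collect_eq continuous_intros continuous_on_product_coordinates)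
  with B have "compact (?B \<inter> {v. (\<Sum>j<k. (v j)\<^sup>2) = 1})" by (rule compact_Int_closed)
  moreover have "?K = ?B \<inter> {v. (\<Sum>j<k. (v j)\<^sup>2) = 1}"
  proof (intro set_eqI iffI)
    fix v assume v: "v \<in> ?K"
    have "\<bar>v j\<bar> \<le> 1" if "j < k" for j
    proof -
      have "(v j)\<^sup>2 \<le> (\<Sum>j<k. (v j)\<^sup>2)" using that by (intro member_le_sum) auto
      with v show ?thesis by (simp add: abs_square_le_1)
    qed
    with v show "v \<in> ?B \<inter> {v. (\<Sum>j<k. (v j)\<^sup>2) = 1}"
      by (auto simp: PiE_def extensional_def abs_le_iff)
  qed (auto simp: PiE_def extensional_def Pi_def split: if_splits)
  ultimately show ?thesis by simp
qed

text \<open>Along a line through a strict minimizer the objective changes by t^2 q - 2 t l. Adding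
  the cases t = 1 and t = -1 gives q > 0; if l were nonzero, t = l / q would give the negative value
  -l^2 / q.\<close>

lemma quadratic_pos_imp:
  fixes q l :: real
  assumes "0 \<le> q" and pos: "\<And>t. t \<noteq> 0 \<Longrightarrow> 0 < t\<^sup>2 * q - 2 * t * l"
  shows "0 < q" "l = 0"
proof -
  from pos[of 1] pos[of "-1"] show q: "0 < q" by simp
  show "l = 0"
  proof (rule ccontr)
    assume "l \<noteq> 0"
    then have "0 < (l/q)\<^sup>2 * q - 2 * (l/q) * l" using q by (intro pos) auto
    also have "\<dots> = - (l\<^sup>2 / q)" using q by (simp add: power2_eq_square field_simps)
    finally show False using q by (simp add: divide_less_0_iff)
  qed
qed

lemma Rvec_eqI: "u \<in> Rvec k \<Longrightarrow> v \<in> Rvec k \<Longrightarrow> (\<And>j. j < k \<Longrightarrow> u j = v j) \<Longrightarrow> u = v"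
  unfolding Rvec_def by (rule PiE_ext) auto

lemma vdist_eq_0_iff: "u \<in> Rvec k \<Longrightarrow> v \<in> Rvec k \<Longrightarrow> vdist k u v = 0 \<longleftrightarrow> u = v"
  by (auto simp: vdist_def L2_set_eq_0_iff intro: Rvec_eqI)

lemma vdist_nonneg [simp]: "0 \<le> vdist k u v"
  by (simp add: vdist_def)

lemma vdist_sq: "(vdist k u v)\<^sup>2 = (\<Sum>j<k. (u j - v j)\<^sup>2)"
  by (simp add: vdist_def L2_set_def sum_nonneg)

lemma ip_diff_right: "ip k x (\<lambda>j. u j - v j) = ip k x u - ip k x v"
  by (simp add: ip_def sum_subtractf right_diff_distrib)

text \<open>
  The right-hand side quantifies over countable sets only, which makes the event measurable.
\<close>

lemma unique_least_squares_iff: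
  fixes x :: "'i \<Rightarrow> nat \<Rightarrow> real" and y :: "'i \<Rightarrow> real" and A :: "'i set"
  assumes bs: "bs \<in> Rvec k"
  defines "f \<equiv> \<lambda>b. \<Sum>i\<in>A. (y i - ip k (x i) b)\<^sup>2"
  shows "(\<forall>b\<in>Rvec k. b \<noteq> bs \<longrightarrow> f bs < f b) \<longleftrightarrow>
    (\<exists>m::nat. \<forall>b\<in>{..<k} \<rightarrow>\<^sub>E \<rat>. f bs + (\<Sum>j<k. (b j - bs j)\<^sup>2) / real (Suc m) \<le> f b)" (is "?U \<longleftrightarrow> ?R")
proof
  assume U: ?U
  define q where "q v = (\<Sum>i\<in>A. (ip k (x i) v)\<^sup>2)" for v
  define l where "l v = (\<Sum>i\<in>A. (y i - ip k (x i) bs) * ip k (x i) v)" for v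
  let ?K = "{v \<in> {..<k} \<rightarrow>\<^sub>E (UNIV :: real set). (\<Sum>j<k. (v j)\<^sup>2) = 1}"
  \<comment> \<open>The expansion about \<open>bs\<close> is exact, the objective being quadratic:
    \<open>q\<close> is its curvature and \<open>l\<close> pairs the residuals with the
    direction.\<close>
  have f: "f b = f bs + t\<^sup>2 * q v - 2 * t * l v" if b: "\<And>j. j < k \<Longrightarrow> b j = bs j + t * v j" for b t v
  proof -
    have "ip k (x i) b = ip k (x i) bs + t * ip k (x i) v" for i
      using b by (simp add: ip_def algebra_simps sum.distrib sum_distrib_left)
    then have "f b = (\<Sum>i\<in>A. (y i - ip k (x i) bs)\<^sup>2 + (t\<^sup>2 * (ip k (x i) v)\<^sup>2 - 2 * t * ((y i - ip k (x i) bs) * ip k (x i) v)))"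
      unfolding f_def by (intro sum.cong) (auto simp: power2_eq_square algebra_simps)
    then show ?thesis
      by (simp add: sum.distrib sum_subtractf sum_distrib_left[symmetric] f_def q_def l_def)
  qed
  have ql: "0 < q v \<and> l v = 0" if v: "v \<in> ?K" for v
  proof -
    have "0 < t\<^sup>2 * q v - 2 * t * l v" if "t \<noteq> 0" for t
    proof -
      let ?b = "\<lambda>j\<in>{..<k}. bs j + t * v j"
      have "\<exists>j<k. v j \<noteq> 0" using v by (auto intro: ccontr)
      then obtain j where "j < k" "v j \<noteq> 0" by blast
      then have "?b j \<noteq> bs j" using \<open>t \<noteq> 0\<close> by simp
      then have "?b \<noteq> bs" by metis
      then have "f bs < f ?b" using U by (auto simp: Rvec_def)
      moreover have "f ?b = f bs + t\<^sup>2 * q v - 2 * t * l v" by (rule f) simp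
      ultimately show ?thesis by simp
    qed
    moreover have "0 \<le> q v" by (simp add: q_def sum_nonneg)
    ultimately show ?thesis using quadratic_pos_imp by blast
  qed
  \<comment> \<open>The least curvature over unit directions is attained by compactness and gives
    the rate of quadratic growth, below which some \<open>1 / real (Suc m)\<close> lies. The sphere
    is empty only for \<open>k = 0\<close>, where the value 1 is arbitrary.\<close>
  obtain c where c: "0 < c" "\<And>v. v \<in> ?K \<Longrightarrow> c \<le> q v"
  proof (cases "?K = {}")
    case True
    then show ?thesis using that[of 1] by auto
  next
    case False
    have "continuous_on ?K q"
      unfolding q_def ip_def
      by (intro continuous_on_sum continuous_on_power continuous_on_mult continuous_on_const
          continuous_on_subset[OF continuous_on_product_coordinates subset_UNIV])
    from continuous_attains_inf[OF compact_unit_sphere_PiE False this]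
    obtain v where v: "v \<in> ?K" and le: "\<forall>u\<in>?K. q v \<le> q u" by (rule bexE)
    show ?thesis
    proof (rule that[of "q v"])
      show "0 < q v" using ql[OF v] by (rule conjunct1)
      show "q v \<le> q u" if "u \<in> ?K" for u using le that by (rule bspec)
    qed
  qed
  obtain m where m: "1 / real (Suc m) \<le> c"
    using reals_Archimedean[OF c(1)] by (auto simp: inverse_eq_divide intro: less_imp_le)
  show ?R
  proof (intro exI ballI)
    fix b assume "b \<in> {..<k} \<rightarrow>\<^sub>E (\<rat> :: real set)"
    let ?d = "vdist k b bs"
    show "f bs + (\<Sum>j<k. (b j - bs j)\<^sup>2) / real (Suc m) \<le> f b"
    proof (cases "?d = 0")
      case True
      then have "\<And>j. j < k \<Longrightarrow> b j = bs j + 0 * bs j" by (simp add: vdist_def L2_set_eq_0_iff)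
      from f[OF this] show ?thesis using True by (simp add: vdist_sq[symmetric])
    next
      case False
      let ?v = "\<lambda>j\<in>{..<k}. (b j - bs j) / ?d"
      have "(\<Sum>j<k. (?v j)\<^sup>2) = (vdist k b bs)\<^sup>2 / ?d\<^sup>2"
        by (simp add: power_divide sum_divide_distrib[symmetric] vdist_sq)
      then have v: "?v \<in> ?K" using False by simp
      have "f b = f bs + ?d\<^sup>2 * q ?v - 2 * ?d * l ?v"
        using False by (intro f) simp
      also have "\<dots> = f bs + ?d\<^sup>2 * q ?v" using ql[OF v] by simp
      finally have "f b = f bs + ?d\<^sup>2 * q ?v" .
      moreover have "?d\<^sup>2 * (1 / real (Suc m)) \<le> ?d\<^sup>2 * q ?v"
        using c(2)[OF v] m by (intro mult_left_mono) auto
      ultimately show ?thesis by (simp add: vdist_sq[symmetric])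
    qed
  qed
next
  assume ?R
  then obtain m where m: "\<And>b. b \<in> {..<k} \<rightarrow>\<^sub>E \<rat> \<Longrightarrow> f bs + (\<Sum>j<k. (b j - bs j)\<^sup>2) / real (Suc m) \<le> f b"
    by blast
  show ?U
  proof (intro ballI impI)
    fix b assume b: "b \<in> Rvec k" "b \<noteq> bs"
    \<comment> \<open>Both sides of the growth inequality are continuous in \<open>b\<close>, so it
      passes from rational to real vectors; its added term is positive for \<open>b\<close> other
      than \<open>bs\<close>.\<close>
    have "\<exists>r. (\<forall>m. r m \<in> \<rat>) \<and> r \<longlonglongrightarrow> b j" for j using real_rat_sequence[of "b j"] by metis
    then obtain r where r: "\<And>j m. r j m \<in> \<rat>" "\<And>j. r j \<longlonglongrightarrow> b j" by metis
    define R where "R m = (\<lambda>j\<in>{..<k}. r j m)" for m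
    have R: "R m \<in> {..<k} \<rightarrow>\<^sub>E \<rat>" for m using r by (auto simp: R_def)
    have Rl: "(\<lambda>m. R m j) \<longlonglongrightarrow> b j" if "j < k" for j using that r by (simp add: R_def)
    have 1: "(\<lambda>n. f (R n)) \<longlonglongrightarrow> f b"
      unfolding f_def ip_def by (intro tendsto_intros Rl) auto
    have 2: "(\<lambda>n. f bs + (\<Sum>j<k. (R n j - bs j)\<^sup>2) / real (Suc m)) \<longlonglongrightarrow> f bs + (\<Sum>j<k. (b j - bs j)\<^sup>2) / real (Suc m)"
      by (intro tendsto_intros Rl) auto
    have "f bs + (\<Sum>j<k. (b j - bs j)\<^sup>2) / real (Suc m) \<le> f b"
      using m[OF R] by (intro LIMSEQ_le[OF 2 1]) auto
    moreover have "0 < (\<Sum>j<k. (b j - bs j)\<^sup>2) / real (Suc m)"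
      using vdist_eq_0_iff[OF b(1) bs] b(2) by (simp add: vdist_sq[symmetric] zero_less_divide_iff)
    ultimately show "f bs < f b" by linarith
  qed
qed

lemma pred_unique_least_squares:
  assumes bs: "bs \<in> Rvec k"
    and y: "\<And>i. i \<in> A \<Longrightarrow> (\<lambda>w. y w i) \<in> borel_measurable M"
    and x: "\<And>i j. i \<in> A \<Longrightarrow> j < k \<Longrightarrow> (\<lambda>w. x w i j) \<in> borel_measurable M"
  shows "Measurable.pred M (\<lambda>w. \<forall>b\<in>Rvec k. b \<noteq> bs \<longrightarrow>
    (\<Sum>i\<in>A. (y w i - ip k (x w i) bs)\<^sup>2) < (\<Sum>i\<in>A. (y w i - ip k (x w i) b)\<^sup>2))"
  unfolding unique_least_squares_iff[OF bs]
proof -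
  have [measurable]: "(\<lambda>w. \<Sum>i\<in>A. (y w i - ip k (x w i) b)\<^sup>2) \<in> borel_measurable M" for b
    unfolding ip_def using y x by (intro borel_measurable_sum borel_measurable_power borel_measurable_diff borel_measurable_times) auto
  have "Measurable.pred M (\<lambda>w. (\<Sum>i\<in>A. (y w i - ip k (x w i) bs)\<^sup>2) + (\<Sum>j<k. (b j - bs j)\<^sup>2) / real (Suc m)
      \<le> (\<Sum>i\<in>A. (y w i - ip k (x w i) b)\<^sup>2))" for m b
    by measurable
  then show "Measurable.pred M (\<lambda>w. \<exists>m::nat. \<forall>b\<in>{..<k} \<rightarrow>\<^sub>E \<rat>.
      (\<Sum>i\<in>A. (y w i - ip k (x w i) bs)\<^sup>2) + (\<Sum>j<k. (b j - bs j)\<^sup>2) / real (Suc m)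
      \<le> (\<Sum>i\<in>A. (y w i - ip k (x w i) b)\<^sup>2))"
    by (intro pred_intros_countable(2) measurable_pred_countable(1) countable_PiE_Rats)
qed

section \<open>Existence of least-squares minimizers\<close>

text \<open>Gram-Schmidt by induction on the number of columns, for any rank. \<open>y\<close> is
  arbitrary in the induction because the hypothesis is applied to the new column as well.\<close>

lemma normal_equations_solution:
  fixes x :: "'i \<Rightarrow> nat \<Rightarrow> real"
  assumes A: "finite A"
  shows "\<exists>b. \<forall>l<k. (\<Sum>i\<in>A. (y i - ip k (x i) b) * x i l) = 0"
proof (induction k arbitrary: y)
  case (Suc k)
  obtain b where b: "\<And>l. l < k \<Longrightarrow> (\<Sum>i\<in>A. (y i - ip k (x i) b) * x i l) = 0"
    using Suc.IH[of y] by blast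
  obtain c where c: "\<And>l. l < k \<Longrightarrow> (\<Sum>i\<in>A. (x i k - ip k (x i) c) * x i l) = 0"
    using Suc.IH[of "\<lambda>i. x i k"] by blast
  define p where "p i = x i k - ip k (x i) c" for i
  define r where "r i = y i - ip k (x i) b" for i
  \<comment> \<open>The coefficient of the projection of \<open>r\<close> onto \<open>p\<close>. If
    \<open>p\<close> vanishes on \<open>A\<close>, it is 0 by division by zero, and the
    orthogonality to \<open>p\<close> is trivial.\<close>
  define s where "s = (\<Sum>i\<in>A. r i * p i) / (\<Sum>i\<in>A. p i * p i)"
  have orth_p: "(\<Sum>i\<in>A. (r i - s * p i) * p i) = 0"
  proof (cases "(\<Sum>i\<in>A. p i * p i) = 0")
    case True
    then have "\<And>i. i \<in> A \<Longrightarrow> p i = 0" using A by (simp add: sum_nonneg_eq_0_iff)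
    then show ?thesis by simp
  next
    case False
    have "(\<Sum>i\<in>A. (r i - s * p i) * p i) = (\<Sum>i\<in>A. r i * p i) - s * (\<Sum>i\<in>A. p i * p i)"
      by (simp add: left_diff_distrib sum_subtractf sum_distrib_left mult.assoc)
    also have "\<dots> = 0" using False by (simp add: s_def)
    finally show ?thesis .
  qed
  have orth: "(\<Sum>i\<in>A. (r i - s * p i) * x i l) = 0" if "l < k" for l
  proof -
    have "(\<Sum>i\<in>A. (r i - s * p i) * x i l) = (\<Sum>i\<in>A. r i * x i l) - s * (\<Sum>i\<in>A. p i * x i l)"
      by (simp add: left_diff_distrib sum_subtractf sum_distrib_left mult.assoc)
    then show ?thesis using b[OF that] c[OF that] by (simp add: r_def p_def)
  qed
  \<comment> \<open>Column \<open>k\<close> is \<open>p\<close> plus a combination of the earlier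
    columns, and the new residual is orthogonal to all of these.\<close>
  have orth_k: "(\<Sum>i\<in>A. (r i - s * p i) * x i k) = 0"
  proof -
    have "(\<Sum>i\<in>A. (r i - s * p i) * x i k)
        = (\<Sum>i\<in>A. (r i - s * p i) * p i) + (\<Sum>i\<in>A. \<Sum>l<k. c l * ((r i - s * p i) * x i l))"
      unfolding sum.distrib[symmetric]
      by (intro sum.cong refl)
         (simp add: p_def ip_def algebra_simps sum_distrib_left sum.distrib sum_subtractf)
    also have "(\<Sum>i\<in>A. \<Sum>l<k. c l * ((r i - s * p i) * x i l)) = (\<Sum>l<k. c l * (\<Sum>i\<in>A. (r i - s * p i) * x i l))"
      by (subst sum.swap) (simp add: sum_distrib_left)
    also have "\<dots> = 0" using orth by simp
    finally show ?thesis using orth_p by simp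
  qed
  \<comment> \<open>The fit is \<open>b\<close> plus \<open>s\<close> times \<open>p\<close>, and
    \<open>p\<close> is column \<open>k\<close> minus its own fit \<open>c\<close>; collecting
    coefficients gives \<open>b - s c\<close> on the old columns and \<open>s\<close> on the new
    one.\<close>
  define b' where "b' j = (if j < k then b j - s * c j else s)" for j
  have res: "y i - ip (Suc k) (x i) b' = r i - s * p i" for i
  proof -
    have "(\<Sum>j<k. x i j * b' j) = ip k (x i) b - s * ip k (x i) c"
      unfolding ip_def sum_distrib_left sum_subtractf[symmetric]
      by (intro sum.cong) (auto simp: b'_def algebra_simps)
    then have "ip (Suc k) (x i) b' = ip k (x i) b - s * ip k (x i) c + x i k * s"
      by (simp add: ip_def b'_def)
    then show ?thesis by (simp add: r_def p_def algebra_simps)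
  qed
  show ?case
    using orth orth_k by (intro exI[of _ b']) (auto simp: res less_Suc_eq)
qed simp

text \<open>The residual of a solution of the normal equations is orthogonal to all fitted values,
  so it is minimal by Pythagoras. Existence keeps statements about all minimizers from being
  vacuous.\<close>

lemma least_squares_exists:
  assumes A: "finite A"
  shows "\<exists>b. least_squares k y x A b"
proof -
  obtain c where c: "\<And>l. l < k \<Longrightarrow> (\<Sum>i\<in>A. (y i - ip k (x i) c) * x i l) = 0"
    using normal_equations_solution[OF A, where k=k and x=x and y=y] by blast
  define b where "b = (\<lambda>j\<in>{..<k}. c j)"
  have ipb: "ip k u b = ip k u c" for u by (simp add: ip_def b_def)
  have "(\<Sum>i\<in>A. (y i - ip k (x i) b)\<^sup>2) \<le> (\<Sum>i\<in>A. (y i - ip k (x i) a)\<^sup>2)" for a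
  proof -
    let ?d = "\<lambda>j. a j - b j"
    have "(\<Sum>i\<in>A. (y i - ip k (x i) b) * ip k (x i) ?d) = (\<Sum>i\<in>A. \<Sum>l<k. ?d l * ((y i - ip k (x i) c) * x i l))"
      by (intro sum.cong refl) (simp add: ipb ip_def[of k _ ?d] sum_distrib_left mult_ac)
    also have "\<dots> = (\<Sum>l<k. ?d l * (\<Sum>i\<in>A. (y i - ip k (x i) c) * x i l))"
      by (subst sum.swap) (simp add: sum_distrib_left)
    also have "\<dots> = 0" using c by simp
    finally have cross: "(\<Sum>i\<in>A. (y i - ip k (x i) b) * ip k (x i) ?d) = 0" .
    have "(\<Sum>i\<in>A. (y i - ip k (x i) a)\<^sup>2) =
        (\<Sum>i\<in>A. (y i - ip k (x i) b)\<^sup>2 + (ip k (x i) ?d)\<^sup>2 - 2 * ((y i - ip k (x i) b) * ip k (x i) ?d))"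
      by (intro sum.cong refl) (simp add: ip_diff_right power2_eq_square algebra_simps)
    also have "\<dots> = (\<Sum>i\<in>A. (y i - ip k (x i) b)\<^sup>2) + (\<Sum>i\<in>A. (ip k (x i) ?d)\<^sup>2)"
      by (simp add: sum.distrib sum_subtractf sum_distrib_left[symmetric] cross)
    finally show ?thesis by (simp add: sum_nonneg)
  qed
  moreover have "b \<in> Rvec k" by (simp add: b_def Rvec_def)
  ultimately have "least_squares k y x A b"
    unfolding least_squares_def is_arg_min_linorder by blast
  then show ?thesis by (intro exI[of _ b])
qed

text \<open>From left to right, some minimizer exists and can only be \<open>bs\<close>; a vector
  with no larger loss would be a minimizer too. The right-hand side is the form whose measurability
  is known.\<close>

lemma all_least_squares_eq_iff:
  assumes A: "finite A" and bs: "bs \<in> Rvec k"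
  shows "(\<forall>b. least_squares k y x A b \<longrightarrow> b = bs) \<longleftrightarrow>
    (\<forall>b\<in>Rvec k. b \<noteq> bs \<longrightarrow> (\<Sum>i\<in>A. (y i - ip k (x i) bs)\<^sup>2) < (\<Sum>i\<in>A. (y i - ip k (x i) b)\<^sup>2))"
proof
  assume *: "\<forall>b. least_squares k y x A b \<longrightarrow> b = bs"
  then have "least_squares k y x A bs" using least_squares_exists[OF A, of k y x] by metis
  with * show "\<forall>b\<in>Rvec k. b \<noteq> bs \<longrightarrow> (\<Sum>i\<in>A. (y i - ip k (x i) bs)\<^sup>2) < (\<Sum>i\<in>A. (y i - ip k (x i) b)\<^sup>2)"
    unfolding least_squares_def is_arg_min_linorder by (meson linorder_not_less order_trans)
next
  assume *: "\<forall>b\<in>Rvec k. b \<noteq> bs \<longrightarrow> (\<Sum>i\<in>A. (y i - ip k (x i) bs)\<^sup>2) < (\<Sum>i\<in>A. (y i - ip k (x i) b)\<^sup>2)"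
  show "\<forall>b. least_squares k y x A b \<longrightarrow> b = bs"
    using * bs unfolding least_squares_def is_arg_min_linorder by (meson linorder_not_less)
qed

section \<open>Almost sure nonsingularity\<close>

text \<open>Fubini with coordinate \<open>i\<close> integrated first. It serves both levels of
  nesting: the samples, and the entries of one sample.\<close>

lemma emeasure_PiM_zero_if_sections_zero:
  assumes I: "finite I" "i \<in> I" and M: "\<And>i. prob_space (M i)"
    and S: "S \<in> sets (PiM I M)"
    and sec: "\<And>x. x \<in> space (PiM (I - {i}) M) \<Longrightarrow> emeasure (M i) {t \<in> space (M i). x(i := t) \<in> S} = 0"
  shows "emeasure (PiM I M) S = 0"
proof -
  interpret product_sigma_finite M
    using M by (simp add: product_sigma_finite_def prob_space_imp_sigma_finite)
  let ?J = "I - {i}"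
  have ins: "insert i ?J = I" using I by auto
  have "emeasure (PiM I M) S = (\<integral>\<^sup>+x. indicator S x \<partial>PiM (insert i ?J) M)"
    using S by (simp only: ins nn_integral_indicator)
  also have "\<dots> = (\<integral>\<^sup>+x. (\<integral>\<^sup>+t. indicator S (x(i := t)) \<partial>M i) \<partial>PiM ?J M)"
    using I S by (intro product_nn_integral_insert) (auto simp: insert_absorb)
  also have "\<dots> = (\<integral>\<^sup>+x. 0 \<partial>PiM ?J M)"
  proof (rule nn_integral_cong)
    fix x assume x: "x \<in> space (PiM ?J M)"
    have "(\<lambda>t. x(i := t)) \<in> measurable (M i) (PiM I M)"
      using measurable_component_update[OF x, of i] ins by simp
    from measurable_sets[OF this S] have "{t \<in> space (M i). x(i := t) \<in> S} \<in> sets (M i)"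
      by (simp add: vimage_def Collect_conj_eq Int_commute)
    moreover have "(\<integral>\<^sup>+t. indicator S (x(i := t)) \<partial>M i) = (\<integral>\<^sup>+t. indicator {t \<in> space (M i). x(i := t) \<in> S} t \<partial>M i)"
      by (intro nn_integral_cong) (simp add: indicator_def)
    ultimately show "(\<integral>\<^sup>+t. indicator S (x(i := t)) \<partial>M i) = 0"
      using sec[OF x] by simp
  qed
  finally show ?thesis by simp
qed

lemma prob_space_std_gaussian: "prob_space (std_gaussian k)"
  unfolding std_gaussian_def by (intro prob_space_PiM prob_space_std_normal)

lemma emeasure_std_normal_subsingleton:
  assumes "\<And>s t. s \<in> S \<Longrightarrow> t \<in> S \<Longrightarrow> s = t"
  shows "emeasure (density lborel std_normal_density) S = 0"
proof -
  have "S \<subseteq> {SOME s. s \<in> S}"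
    using assms someI[of "\<lambda>s. s \<in> S"] by blast
  then have fin: "finite S" by (rule finite_subset) simp
  then have "S \<in> null_sets lborel" by (rule finite_imp_null_set_lborel)
  then have "(\<integral>\<^sup>+t\<in>S. ennreal (std_normal_density t) \<partial>lborel) = 0" by (rule nn_integral_null_set)
  moreover have "S \<in> sets lborel" using fin by (simp add: borel_closed finite_imp_closed)
  ultimately show ?thesis by (subst emeasure_density) auto
qed

text \<open>Fixing all other samples and then all other entries of sample \<open>i\<close> leaves a
  section with at most one point, which is null for the normal law.\<close>

lemma emeasure_gaussian_sample_zero_if_entry_determined:
  fixes n :: nat
  assumes S: "S \<in> sets (PiM {..<n} (\<lambda>_. std_gaussian k))" and ij: "i < n" "j < k"
    and det: "\<And>x r s t. x(i := r(j := s)) \<in> S \<Longrightarrow> x(i := r(j := t)) \<in> S \<Longrightarrow> s = t"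
  shows "emeasure (PiM {..<n} (\<lambda>_. std_gaussian k)) S = 0"
proof (rule emeasure_PiM_zero_if_sections_zero[OF _ _ prob_space_std_gaussian S, of i])
  fix x assume x: "x \<in> space (PiM ({..<n} - {i}) (\<lambda>_. std_gaussian k))"
  let ?S = "{r \<in> space (std_gaussian k). x(i := r) \<in> S}"
  have ins: "insert i ({..<n} - {i}) = {..<n}" using ij by auto
  have "(\<lambda>r. x(i := r)) \<in> measurable (std_gaussian k) (PiM {..<n} (\<lambda>_. std_gaussian k))"
    using measurable_component_update[OF x, of i] ins by simp
  from measurable_sets[OF this S] have "?S \<in> sets (std_gaussian k)"
    by (simp add: vimage_def Collect_conj_eq Int_commute)
  then show "emeasure (std_gaussian k) ?S = 0"
    unfolding std_gaussian_def
    using ij det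
    by (intro emeasure_PiM_zero_if_sections_zero[of _ j] prob_space_std_normal emeasure_std_normal_subsingleton) auto
qed (use ij in auto)

section \<open>Full rank of Gaussian designs\<close>

text \<open>Trivial kernel of the matrix with rows \<open>x i\<close>; with more than
  \<open>k\<close> rows this is full column rank.\<close>

definition nonsingular :: "nat \<Rightarrow> 'i set \<Rightarrow> ('i \<Rightarrow> nat \<Rightarrow> real) \<Rightarrow> bool" where
  "nonsingular k A x \<longleftrightarrow> (\<forall>v. (\<forall>i\<in>A. ip k (x i) v = 0) \<longrightarrow> (\<forall>l<k. v l = 0))"

lemma measurable_entry:
  fixes n :: nat
  assumes "i < n" "j < k"
  shows "(\<lambda>x. x i j) \<in> borel_measurable (PiM {..<n} (\<lambda>_. std_gaussian k))"
proof -
  have "(\<lambda>x. x i) \<in> measurable (PiM {..<n} (\<lambda>_. std_gaussian k)) (std_gaussian k)"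
    using assms by (intro measurable_component_singleton) auto
  moreover have "(\<lambda>r. r j) \<in> borel_measurable (std_gaussian k)"
    using measurable_component_singleton[of j "{..<k}" "\<lambda>_. density lborel std_normal_density"] assms
    by (simp add: std_gaussian_def measurable_def)
  ultimately show ?thesis by (rule measurable_compose)
qed

text \<open>Nonsingularity means that 0 is the unique least-squares solution for zero responses, so
  the countable characterization of unique minimality replaces the quantifier over all
  \<open>v\<close>.\<close>

lemma pred_nonsingular:
  assumes A: "finite A" and x: "\<And>i j. i \<in> A \<Longrightarrow> j < k \<Longrightarrow> (\<lambda>w. x w i j) \<in> borel_measurable M"
  shows "Measurable.pred M (\<lambda>w. nonsingular k A (x w))"
proof -
  let ?z = "\<lambda>j\<in>{..<k}. 0 :: real"
  have ipz: "ip k u ?z = 0" for u by (simp add: ip_def)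
  have eq: "nonsingular k A (x w) \<longleftrightarrow> (\<forall>b\<in>Rvec k. b \<noteq> ?z \<longrightarrow>
      (\<Sum>i\<in>A. (0 - ip k (x w i) ?z)\<^sup>2) < (\<Sum>i\<in>A. (0 - ip k (x w i) b)\<^sup>2))" (is "_ \<longleftrightarrow> ?R") for w
  proof -
    have pos: "0 < (\<Sum>i\<in>A. (ip k (x w i) b)\<^sup>2) \<longleftrightarrow> \<not> (\<forall>i\<in>A. ip k (x w i) b = 0)" for b
      using A by (simp add: less_le sum_nonneg sum_nonneg_eq_0_iff eq_commute[of 0])
    have "?R \<longleftrightarrow> (\<forall>b\<in>Rvec k. (\<forall>i\<in>A. ip k (x w i) b = 0) \<longrightarrow> b = ?z)"
      unfolding ipz using pos by auto
    also have "\<dots> \<longleftrightarrow> nonsingular k A (x w)"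
    proof
      assume *: "\<forall>b\<in>Rvec k. (\<forall>i\<in>A. ip k (x w i) b = 0) \<longrightarrow> b = ?z"
      show "nonsingular k A (x w)"
        unfolding nonsingular_def
      proof (intro allI impI)
        fix v l assume v: "\<forall>i\<in>A. ip k (x w i) v = 0" and l: "l < k"
        let ?b = "\<lambda>j\<in>{..<k}. v j"
        have "ip k u ?b = ip k u v" for u by (simp add: ip_def)
        with v have "\<forall>i\<in>A. ip k (x w i) ?b = 0" by simp
        moreover have "?b \<in> Rvec k" by (simp add: Rvec_def)
        ultimately have "?b = ?z" using * by blast
        from fun_cong[OF this, of l] show "v l = 0" using l by simp
      qed
    next
      assume "nonsingular k A (x w)"
      then show "\<forall>b\<in>Rvec k. (\<forall>i\<in>A. ip k (x w i) b = 0) \<longrightarrow> b = ?z"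
        unfolding nonsingular_def by (auto intro!: Rvec_eqI[of _ k ?z] simp: Rvec_def)
    qed
    finally show ?thesis ..
  qed
  show ?thesis
    unfolding eq
    by (rule pred_unique_least_squares[OF _ _ x]) (auto simp: Rvec_def)
qed

text \<open>
  If the leading minor is nonsingular, the kernel vector of the bordered matrix is determined up to
  scaling by the entries other than the corner, and its last row then determines the corner.
\<close>

lemma nonsingular_Suc_entry_unique:
  assumes ns: "nonsingular j {..<j} X" and X': "\<And>i. i < j \<Longrightarrow> X' i = X i"
    and row: "\<And>l. l < j \<Longrightarrow> X' j l = X j l"
    and sing: "\<not> nonsingular (Suc j) {..<Suc j} X" "\<not> nonsingular (Suc j) {..<Suc j} X'"
  shows "X j j = X' j j"
proof -
  obtain v where v: "\<And>i. i < Suc j \<Longrightarrow> ip (Suc j) (X i) v = 0" "\<exists>l<Suc j. v l \<noteq> 0"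
    using sing(1) unfolding nonsingular_def by auto
  obtain v' where v': "\<And>i. i < Suc j \<Longrightarrow> ip (Suc j) (X' i) v' = 0" "\<exists>l<Suc j. v' l \<noteq> 0"
    using sing(2) unfolding nonsingular_def by auto
  have Suc: "ip (Suc j) u w = ip j u w + u j * w j" for u w by (simp add: ip_def)
  \<comment> \<open>A kernel vector ending in 0 would restrict to one of the leading minor. Hence
    kernel vectors can be scaled to end in 1.\<close>
  have vj: "v j \<noteq> 0"
  proof
    assume "v j = 0"
    then have "\<forall>i<j. ip j (X i) v = 0" using v(1) by (simp add: Suc less_Suc_eq)
    then have "\<forall>l<j. v l = 0" using ns by (auto simp: nonsingular_def)
    with v(2) \<open>v j = 0\<close> show False by (auto simp: less_Suc_eq)
  qed
  have v'j: "v' j \<noteq> 0"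
  proof
    assume "v' j = 0"
    have "ip j (X i) v' = 0" if "i < j" for i
      using v'(1)[of i] X'[OF that] that \<open>v' j = 0\<close> by (simp add: Suc)
    then have "\<forall>l<j. v' l = 0" using ns by (auto simp: nonsingular_def)
    with v'(2) \<open>v' j = 0\<close> show False by (auto simp: less_Suc_eq)
  qed
  have div: "ip j u (\<lambda>l. w l / c) = ip j u w / c" for u w c by (simp add: ip_def sum_divide_distrib)
  have eq: "ip j (X i) (\<lambda>l. v l / v j) = - X i j" if "i < Suc j" for i
    using v(1)[OF that] vj by (simp add: Suc div field_simps)
  have eq': "ip j (X' i) (\<lambda>l. v' l / v' j) = - X' i j" if "i < Suc j" for i
    using v'(1)[OF that] v'j by (simp add: Suc div field_simps)
  have "ip j (X i) (\<lambda>l. v l / v j - v' l / v' j) = 0" if "i < j" for i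
    unfolding ip_diff_right using eq[of i] eq'[of i] X'[OF that] that by simp
  then have "\<And>l. l < j \<Longrightarrow> v l / v j = v' l / v' j" using ns by (fastforce simp: nonsingular_def)
  then have "ip j (X j) (\<lambda>l. v l / v j) = ip j (X' j) (\<lambda>l. v' l / v' j)"
    unfolding ip_def using row by (intro sum.cong) auto
  then show ?thesis using eq eq' by simp
qed

text \<open>Induction over the leading minors of the matrix formed by \<open>k\<close> selected
  samples: if one minor is nonsingular and the next singular, the corner entry is determined by the
  others, a null event.\<close>

lemma AE_nonsingular_square:
  fixes n :: nat and e :: "nat \<Rightarrow> nat"
  assumes e: "inj_on e {..<k}" "e ` {..<k} \<subseteq> {..<n}" and "j \<le> k"
  shows "AE x in PiM {..<n} (\<lambda>_. std_gaussian k). nonsingular j {..<j} (\<lambda>i. x (e i))"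
  using \<open>j \<le> k\<close>
proof (induction j)
  case 0
  then show ?case by (simp add: nonsingular_def)
next
  case (Suc j)
  let ?M = "PiM {..<n} (\<lambda>_. std_gaussian k)"
  have en: "e i < n" if "i < k" for i using e that by auto
  have pred: "Measurable.pred ?M (\<lambda>x. nonsingular m {..<m} (\<lambda>i. x (e i)))" if "m \<le> k" for m
    using that by (intro pred_nonsingular measurable_entry en) auto
  let ?S = "{x \<in> space ?M. nonsingular j {..<j} (\<lambda>i. x (e i)) \<and> \<not> nonsingular (Suc j) {..<Suc j} (\<lambda>i. x (e i))}"
  have S: "?S \<in> sets ?M"
    using pred[of j] pred[of "Suc j"] Suc.prems by (intro predE pred_intros_logic) auto
  have "emeasure ?M ?S = 0"
  proof (rule emeasure_gaussian_sample_zero_if_entry_determined[OF S, of "e j" j])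
    fix x r and s t :: real
    assume 1: "x(e j := r(j := s)) \<in> ?S" and 2: "x(e j := r(j := t)) \<in> ?S"
    \<comment> \<open>By injectivity of \<open>e\<close>, altering sample \<open>e j\<close> leaves
      the rows above the corner unchanged.\<close>
    have ne: "e i \<noteq> e j" if "i < j" for i
      using inj_onD[OF e(1), of i j] that Suc.prems by auto
    have "((x(e j := r(j := s))) (e j)) j = ((x(e j := r(j := t))) (e j)) j"
      by (rule nonsingular_Suc_entry_unique[of j "\<lambda>i. (x(e j := r(j := s))) (e i)" "\<lambda>i. (x(e j := r(j := t))) (e i)"])
         (use 1 2 ne in auto)
    then show "s = t" by simp
  qed (use Suc.prems en in auto)
  then have "AE x in ?M. \<not> (nonsingular j {..<j} (\<lambda>i. x (e i)) \<and> \<not> nonsingular (Suc j) {..<Suc j} (\<lambda>i. x (e i)))"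
    by (subst AE_iff_measurable[OF S]) auto
  moreover have "AE x in ?M. nonsingular j {..<j} (\<lambda>i. x (e i))"
    using Suc.prems by (intro Suc.IH) simp
  ultimately show ?case by eventually_elim blast
qed

text \<open>Any \<open>k\<close> rows of \<open>A\<close> with trivial kernel suffice; further rows
  only add equations.\<close>

lemma AE_nonsingular:
  fixes n :: nat
  assumes A: "A \<subseteq> {..<n}" "k \<le> card A"
  shows "AE x in PiM {..<n} (\<lambda>_. std_gaussian k). nonsingular k A x"
proof -
  have "finite A" using A(1) finite_subset by blast
  then obtain e where e: "bij_betw e {0..<card A} A" using ex_bij_betw_nat_finite by blast
  have inj: "inj_on e {..<k}" and im: "e ` {..<k} \<subseteq> A"
    using e A(2) by (auto simp: bij_betw_def inj_on_def)
  have "AE x in PiM {..<n} (\<lambda>_. std_gaussian k). nonsingular k {..<k} (\<lambda>i. x (e i))"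
    using im A(1) by (intro AE_nonsingular_square inj) auto
  then show ?thesis
    by eventually_elim (use im in \<open>fastforce simp: nonsingular_def\<close>)
qed

section \<open>The EM step\<close>

lemma em_J1_subset: "em_J1 k n y x \<beta>1 \<beta>2 \<subseteq> {..<n}"
  by (auto simp: em_J1_def)

lemma least_squares_in_Rvec: "least_squares k y x J b \<Longrightarrow> b \<in> Rvec k"
  by (simp add: least_squares_def is_arg_min_def)

lemma em_output_cong:
  assumes "\<And>i. i < n \<Longrightarrow> y i = y' i"
  shows "em_output k n y x \<beta>1 \<beta>2 \<beta>1p \<beta>2p \<longleftrightarrow> em_output k n y' x \<beta>1 \<beta>2 \<beta>1p \<beta>2p"
proof -
  have J: "em_J1 k n y x \<beta>1 \<beta>2 = em_J1 k n y' x \<beta>1 \<beta>2" using assms by (auto simp: em_J1_def)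
  have "least_squares k y x J b \<longleftrightarrow> least_squares k y' x J b" if "J \<subseteq> {..<n}" for J b
  proof -
    have "(\<lambda>\<beta>. \<Sum>i\<in>J. (y i - ip k (x i) \<beta>)\<^sup>2) = (\<lambda>\<beta>. \<Sum>i\<in>J. (y' i - ip k (x i) \<beta>)\<^sup>2)"
      using assms that by (intro ext sum.cong) auto
    then show ?thesis unfolding least_squares_def by simp
  qed
  then show ?thesis
    unfolding em_output_def em_J2_def J using em_J1_subset by (metis Diff_subset)
qed

definition em_recovers ::
  "nat \<Rightarrow> nat \<Rightarrow> (nat \<Rightarrow> real) \<Rightarrow> (nat \<Rightarrow> real) \<Rightarrow> (nat \<Rightarrow> real) \<Rightarrow> (nat \<Rightarrow> real)
     \<Rightarrow> (nat \<Rightarrow> bool) \<Rightarrow> (nat \<Rightarrow> nat \<Rightarrow> real) \<Rightarrow> bool" where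
  "em_recovers k n \<beta>1s \<beta>2s \<beta>1 \<beta>2 z x \<longleftrightarrow>
     (\<forall>\<beta>1p \<beta>2p. em_output k n (response k \<beta>1s \<beta>2s z x) x \<beta>1 \<beta>2 \<beta>1p \<beta>2p \<longrightarrow>
        max (vdist k \<beta>1p \<beta>1s) (vdist k \<beta>2p \<beta>2s) = 0)"

text \<open>Reduces the labellings to finitely many, one for each subset of \<open>{..<n}\<close>,
  as joint measurability requires.\<close>

lemma em_recovers_cong:
  assumes "\<And>i. i < n \<Longrightarrow> z i = z' i"
  shows "em_recovers k n \<beta>1s \<beta>2s \<beta>1 \<beta>2 z x \<longleftrightarrow> em_recovers k n \<beta>1s \<beta>2s \<beta>1 \<beta>2 z' x"
  unfolding em_recovers_def using assms
  by (subst em_output_cong[of n _ "response k \<beta>1s \<beta>2s z' x"]) (auto simp: response_def)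

text \<open>The quantifier over pairs of outputs separates because both classes have a minimizer, so
  either component can be held fixed.\<close>

lemma em_recovers_iff:
  assumes \<beta>: "\<beta>1s \<in> Rvec k" "\<beta>2s \<in> Rvec k"
  defines "y \<equiv> response k \<beta>1s \<beta>2s"
  shows "em_recovers k n \<beta>1s \<beta>2s \<beta>1 \<beta>2 z x \<longleftrightarrow>
    (\<forall>b. least_squares k (y z x) x (em_J1 k n (y z x) x \<beta>1 \<beta>2) b \<longrightarrow> b = \<beta>1s) \<and>
    (\<forall>b. least_squares k (y z x) x (em_J2 k n (y z x) x \<beta>1 \<beta>2) b \<longrightarrow> b = \<beta>2s)"
proof -
  let ?J1 = "em_J1 k n (y z x) x \<beta>1 \<beta>2" and ?J2 = "em_J2 k n (y z x) x \<beta>1 \<beta>2"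
  have fin: "finite ?J1" "finite ?J2" by (simp_all add: em_J1_def em_J2_def)
  obtain b1 where b1: "least_squares k (y z x) x ?J1 b1" using least_squares_exists[OF fin(1)] by blast
  obtain b2 where b2: "least_squares k (y z x) x ?J2 b2" using least_squares_exists[OF fin(2)] by blast
  have max0: "max (vdist k c \<beta>1s) (vdist k d \<beta>2s) = 0 \<longleftrightarrow> c = \<beta>1s \<and> d = \<beta>2s"
    if "least_squares k (y z x) x ?J1 c" "least_squares k (y z x) x ?J2 d" for c d
  proof -
    have "max (vdist k c \<beta>1s) (vdist k d \<beta>2s) = 0 \<longleftrightarrow> vdist k c \<beta>1s = 0 \<and> vdist k d \<beta>2s = 0"
      using vdist_nonneg[of k c \<beta>1s] vdist_nonneg[of k d \<beta>2s] by linarith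
    then show ?thesis
      using vdist_eq_0_iff[OF least_squares_in_Rvec[OF that(1)] \<beta>(1)]
        vdist_eq_0_iff[OF least_squares_in_Rvec[OF that(2)] \<beta>(2)] by simp
  qed
  show ?thesis
    unfolding em_recovers_def em_output_def y_def[symmetric] using b1 b2 max0 by blast
qed

lemma borel_measurable_ip_sample:
  fixes n :: nat
  assumes "i < n"
  shows "(\<lambda>x. ip k (x i) b) \<in> borel_measurable (PiM {..<n} (\<lambda>_. std_gaussian k))"
  unfolding ip_def using assms
  by (intro borel_measurable_sum borel_measurable_times borel_measurable_const measurable_entry) auto

lemma borel_measurable_response_sample:
  fixes n :: nat
  assumes "i < n"
  shows "(\<lambda>x. response k \<beta>1s \<beta>2s z x i) \<in> borel_measurable (PiM {..<n} (\<lambda>_. std_gaussian k))"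
  unfolding response_def using assms
  by (intro borel_measurable_add borel_measurable_times borel_measurable_const borel_measurable_ip_sample)

text \<open>
  Measurability has to be proved exactly, not just up to null sets: the product measure is not
  complete, and \<^const>\<open>measure\<close> is \<open>0\<close> outside the sigma-algebra.
\<close>

lemma pred_em_recovers:
  assumes \<beta>: "\<beta>1s \<in> Rvec k" "\<beta>2s \<in> Rvec k"
  shows "Measurable.pred (PiM {..<n} (\<lambda>_. std_gaussian k)) (em_recovers k n \<beta>1s \<beta>2s \<beta>1 \<beta>2 z)"
proof -
  let ?M = "PiM {..<n} (\<lambda>_. std_gaussian k)"
  let ?y = "response k \<beta>1s \<beta>2s z"
  let ?U = "\<lambda>x A bs. \<forall>b\<in>Rvec k. b \<noteq> bs \<longrightarrow>
    (\<Sum>i\<in>A. (?y x i - ip k (x i) bs)\<^sup>2) < (\<Sum>i\<in>A. (?y x i - ip k (x i) b)\<^sup>2)"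
  have U: "Measurable.pred ?M (\<lambda>x. ?U x A bs)" if "A \<subseteq> {..<n}" "bs \<in> Rvec k" for A bs
    using that(1)
    by (intro pred_unique_least_squares that(2) borel_measurable_response_sample measurable_entry) auto
  have J: "Measurable.pred ?M (\<lambda>x. em_J1 k n (?y x) x \<beta>1 \<beta>2 = A)" if "A \<subseteq> {..<n}" for A
  proof -
    have "em_J1 k n (?y x) x \<beta>1 \<beta>2 = A \<longleftrightarrow>
        (\<forall>i\<in>{..<n}. (\<bar>?y x i - ip k (x i) \<beta>1\<bar> < \<bar>?y x i - ip k (x i) \<beta>2\<bar>) = (i \<in> A))" for x
      using that by (auto simp: em_J1_def)
    moreover have "Measurable.pred ?M (\<lambda>x. \<forall>i\<in>{..<n}.
        (\<bar>?y x i - ip k (x i) \<beta>1\<bar> < \<bar>?y x i - ip k (x i) \<beta>2\<bar>) = (i \<in> A))"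
    proof (intro measurable_pred_countable(1))
      fix i assume "i \<in> {..<n}"
      then have i: "i < n" by simp
      note [measurable] = borel_measurable_ip_sample[OF i] borel_measurable_response_sample[OF i]
      show "Measurable.pred ?M (\<lambda>x. (\<bar>?y x i - ip k (x i) \<beta>1\<bar> < \<bar>?y x i - ip k (x i) \<beta>2\<bar>) = (i \<in> A))"
        by measurable
    qed simp
    ultimately show ?thesis by simp
  qed
  \<comment> \<open>The class found by EM depends on \<open>x\<close>; splitting by its finitely
    many values \<open>A\<close> leaves sums over fixed index sets.\<close>
  have "em_recovers k n \<beta>1s \<beta>2s \<beta>1 \<beta>2 z x \<longleftrightarrow>
      (\<exists>A\<in>Pow {..<n}. em_J1 k n (?y x) x \<beta>1 \<beta>2 = A \<and> ?U x A \<beta>1s \<and> ?U x ({..<n} - A) \<beta>2s)" (is "_ \<longleftrightarrow> ?R") for x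
  proof -
    have fin: "finite (em_J1 k n (?y x) x \<beta>1 \<beta>2)" by (simp add: em_J1_def)
    have fin': "finite ({..<n} - em_J1 k n (?y x) x \<beta>1 \<beta>2)" by simp
    have "?R \<longleftrightarrow> ?U x (em_J1 k n (?y x) x \<beta>1 \<beta>2) \<beta>1s \<and> ?U x ({..<n} - em_J1 k n (?y x) x \<beta>1 \<beta>2) \<beta>2s"
      using em_J1_subset[of k n "?y x" x \<beta>1 \<beta>2] by blast
    moreover have "em_recovers k n \<beta>1s \<beta>2s \<beta>1 \<beta>2 z x \<longleftrightarrow>
        ?U x (em_J1 k n (?y x) x \<beta>1 \<beta>2) \<beta>1s \<and> ?U x ({..<n} - em_J1 k n (?y x) x \<beta>1 \<beta>2) \<beta>2s"
      unfolding em_recovers_iff[OF \<beta>] em_J2_def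
        all_least_squares_eq_iff[OF fin \<beta>(1)] all_least_squares_eq_iff[OF fin' \<beta>(2)] ..
    ultimately show ?thesis by (simp only:)
  qed
  then have eq: "em_recovers k n \<beta>1s \<beta>2s \<beta>1 \<beta>2 z = (\<lambda>x.
      \<exists>A\<in>Pow {..<n}. em_J1 k n (?y x) x \<beta>1 \<beta>2 = A \<and> ?U x A \<beta>1s \<and> ?U x ({..<n} - A) \<beta>2s)"
    by (rule ext)
  show ?thesis
    unfolding eq
  proof (rule measurable_pred_countable(2))
    fix A assume "A \<in> Pow {..<n}"
    then have "A \<subseteq> {..<n}" by simp
    then show "Measurable.pred ?M (\<lambda>x. em_J1 k n (?y x) x \<beta>1 \<beta>2 = A \<and> ?U x A \<beta>1s \<and> ?U x ({..<n} - A) \<beta>2s)"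
      by (intro pred_intros_logic(3) J U \<beta> Diff_subset)
  qed (simp add: countable_finite)
qed

text \<open>Only the first \<open>n\<close> labels matter, so the event is a finite union of
  rectangles; every set of labellings is measurable for a pmf.\<close>

lemma sets_em_recovers:
  assumes \<beta>: "\<beta>1s \<in> Rvec k" "\<beta>2s \<in> Rvec k"
  shows "{(z, x) \<in> space (sample_law Q k n). em_recovers k n \<beta>1s \<beta>2s \<beta>1 \<beta>2 z x} \<in> sets (sample_law Q k n)"
proof -
  let ?M = "PiM {..<n} (\<lambda>_. std_gaussian k)"
  let ?E = "\<lambda>A. {z. \<forall>i<n. z i = (i \<in> A)} \<times> {x \<in> space ?M. em_recovers k n \<beta>1s \<beta>2s \<beta>1 \<beta>2 (\<lambda>i. i \<in> A) x}"
  have "{(z, x) \<in> space (sample_law Q k n). em_recovers k n \<beta>1s \<beta>2s \<beta>1 \<beta>2 z x} = (\<Union>A\<in>Pow {..<n}. ?E A)"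
  proof (intro subset_antisym subsetI)
    fix w assume w: "w \<in> {(z, x) \<in> space (sample_law Q k n). em_recovers k n \<beta>1s \<beta>2s \<beta>1 \<beta>2 z x}"
    obtain z x where wzx: "w = (z, x)" by (rule prod.exhaust)
    let ?A = "{i. i < n \<and> z i}"
    have x: "x \<in> space ?M" and rec: "em_recovers k n \<beta>1s \<beta>2s \<beta>1 \<beta>2 z x"
      using w by (simp_all add: wzx sample_law_def space_pair_measure)
    have "em_recovers k n \<beta>1s \<beta>2s \<beta>1 \<beta>2 (\<lambda>i. i \<in> ?A) x"
      using rec by (rule em_recovers_cong[THEN iffD1, rotated]) simp
    with x have "w \<in> ?E ?A" by (simp add: wzx)
    moreover have "?A \<in> Pow {..<n}" by auto
    ultimately show "w \<in> (\<Union>A\<in>Pow {..<n}. ?E A)" by (rule UN_I[rotated])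
  next
    fix w assume "w \<in> (\<Union>A\<in>Pow {..<n}. ?E A)"
    then obtain A where w: "w \<in> ?E A" by (rule UN_E)
    obtain z x where wzx: "w = (z, x)" by (rule prod.exhaust)
    have z: "\<And>i. i < n \<Longrightarrow> (i \<in> A) = z i" and x: "x \<in> space ?M"
      and rec: "em_recovers k n \<beta>1s \<beta>2s \<beta>1 \<beta>2 (\<lambda>i. i \<in> A) x"
      using w by (simp_all add: wzx)
    have "em_recovers k n \<beta>1s \<beta>2s \<beta>1 \<beta>2 z x"
      using rec by (rule em_recovers_cong[THEN iffD1, rotated]) (rule z)
    with x show "w \<in> {(z, x) \<in> space (sample_law Q k n). em_recovers k n \<beta>1s \<beta>2s \<beta>1 \<beta>2 z x}"
      by (simp add: wzx sample_law_def space_pair_measure)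
  qed
  moreover have "?E A \<in> sets (sample_law Q k n)" for A
    unfolding sample_law_def by (intro pair_measureI predE pred_em_recovers \<beta>) simp
  then have "(\<Union>A\<in>Pow {..<n}. ?E A) \<in> sets (sample_law Q k n)"
    by (intro sets.finite_UN) auto
  ultimately show ?thesis by (simp only:)
qed

section \<open>From correct classification to recovery with high probability\<close>

text \<open>Without noise, the residuals compared by EM are the inner products of \<open>x i\<close>
  with the true vector minus each iterate, so the inequalities make the EM classes agree with the
  labels.\<close>

lemma em_recovers_if_classified:
  assumes \<beta>: "\<beta>1s \<in> Rvec k" "\<beta>2s \<in> Rvec k"
    and cls: "\<And>i. i < n \<Longrightarrow> z i \<Longrightarrow> \<bar>ip k (x i) (\<lambda>j. \<beta>1s j - \<beta>1 j)\<bar> < \<bar>ip k (x i) (\<lambda>j. \<beta>1s j - \<beta>2 j)\<bar>"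
      "\<And>i. i < n \<Longrightarrow> \<not> z i \<Longrightarrow> \<bar>ip k (x i) (\<lambda>j. \<beta>2s j - \<beta>2 j)\<bar> < \<bar>ip k (x i) (\<lambda>j. \<beta>2s j - \<beta>1 j)\<bar>"
    and ns: "nonsingular k {i\<in>{..<n}. z i} x" "nonsingular k {i\<in>{..<n}. \<not> z i} x"
  shows "em_recovers k n \<beta>1s \<beta>2s \<beta>1 \<beta>2 z x"
proof -
  let ?y = "response k \<beta>1s \<beta>2s z x"
  have J1: "em_J1 k n ?y x \<beta>1 \<beta>2 = {i\<in>{..<n}. z i}"
    unfolding em_J1_def
  proof (intro Collect_cong conj_cong refl)
    fix i assume i: "i \<in> {..<n}"
    show "\<bar>?y i - ip k (x i) \<beta>1\<bar> < \<bar>?y i - ip k (x i) \<beta>2\<bar> \<longleftrightarrow> z i"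
      using cls[of i] i by (cases "z i") (simp_all add: response_def ip_diff_right)
  qed
  then have J2: "em_J2 k n ?y x \<beta>1 \<beta>2 = {i\<in>{..<n}. \<not> z i}" by (auto simp: em_J2_def)
  \<comment> \<open>The true vector has loss 0 on its class, so every minimizer interpolates too,
    and the difference lies in the trivial kernel.\<close>
  have unique: "b = bs" if A: "finite A" and bs: "bs \<in> Rvec k" and ns: "nonsingular k A x"
    and y: "\<And>i. i \<in> A \<Longrightarrow> ?y i = ip k (x i) bs" and b: "least_squares k ?y x A b" for A b bs
  proof -
    have "(\<Sum>i\<in>A. (?y i - ip k (x i) b)\<^sup>2) \<le> (\<Sum>i\<in>A. (?y i - ip k (x i) bs)\<^sup>2)"
      using b bs unfolding least_squares_def is_arg_min_linorder by blast
    also have "\<dots> = 0" using y by simp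
    finally have "(\<Sum>i\<in>A. (?y i - ip k (x i) b)\<^sup>2) = 0" by (simp add: sum_nonneg order_antisym)
    then have "\<forall>i\<in>A. ?y i - ip k (x i) b = 0" using A by (simp add: sum_nonneg_eq_0_iff)
    then have "\<forall>i\<in>A. ip k (x i) (\<lambda>j. bs j - b j) = 0" using y by (simp add: ip_diff_right)
    then have "\<And>j. j < k \<Longrightarrow> bs j = b j" using ns unfolding nonsingular_def by fastforce
    then show "b = bs" using least_squares_in_Rvec[OF b] bs by (intro Rvec_eqI[of b k bs]) auto
  qed
  have "b = \<beta>1s" if "least_squares k ?y x {i\<in>{..<n}. z i} b" for b
    by (rule unique[OF _ \<beta>(1) ns(1) _ that]) (auto simp: response_def)
  moreover have "b = \<beta>2s" if "least_squares k ?y x {i\<in>{..<n}. \<not> z i} b" for b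
    by (rule unique[OF _ \<beta>(2) ns(2) _ that]) (auto simp: response_def)
  ultimately show ?thesis unfolding em_recovers_iff[OF \<beta>] J1 J2 by blast
qed

lemma prob_space_gaussian_sample: "prob_space (PiM {..<n} (\<lambda>_. std_gaussian k))"
  by (intro prob_space_PiM prob_space_std_gaussian)

lemma emeasure_gaussian_sample_ratio_le:
  fixes n :: nat
  assumes i: "i < n" and \<eta>: "0 < \<eta>" "L2_set u {..<k} \<le> \<eta>" and w: "0 < w" "w \<le> L2_set v {..<k}"
  shows "emeasure (PiM {..<n} (\<lambda>_. std_gaussian k))
      {x \<in> space (PiM {..<n} (\<lambda>_. std_gaussian k)). \<bar>ip k (x i) v\<bar> \<le> \<bar>ip k (x i) u\<bar>} \<le> ennreal (16 * (\<eta> / w))"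
proof -
  let ?M = "PiM {..<n} (\<lambda>_. std_gaussian k)"
  let ?B = "{r \<in> space (std_gaussian k). \<bar>\<Sum>j<k. v j * r j\<bar> \<le> \<bar>\<Sum>j<k. u j * r j\<bar>}"
  have i': "i \<in> {..<n}" using i by simp
  note [measurable] = borel_measurable_linear_PiM[of _ "{..<k}", folded std_gaussian_def]
  have B: "?B \<in> sets (std_gaussian k)" by measurable
  have "{x \<in> space ?M. \<bar>ip k (x i) v\<bar> \<le> \<bar>ip k (x i) u\<bar>} = (\<lambda>x. x i) -` ?B \<inter> space ?M"
    using i by (auto simp: ip_def mult.commute space_PiM)
  also have "emeasure ?M \<dots> = emeasure (distr ?M (std_gaussian k) (\<lambda>x. x i)) ?B"
    using B measurable_component_singleton[OF i', of "\<lambda>_. std_gaussian k"]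
    by (subst emeasure_distr) auto
  also have "distr ?M (std_gaussian k) (\<lambda>x. x i) = std_gaussian k"
    by (rule distr_PiM_component[OF prob_space_std_gaussian i'])
  also have "emeasure (std_gaussian k) ?B \<le> ennreal (16 * (\<eta> / w))"
    unfolding std_gaussian_def by (rule emeasure_std_gaussian_ratio_le[OF _ \<eta> w]) simp
  finally show ?thesis .
qed

lemma vdist_commute: "vdist k u v = vdist k v u"
  unfolding vdist_def L2_set_def by (simp add: power2_commute)

lemma vdist_triangle: "vdist k u w \<le> vdist k u v + vdist k v w"
  using L2_set_triangle_ineq[of "\<lambda>j. u j - v j" "\<lambda>j. v j - w j" "{..<k}"] by (simp add: vdist_def)

text \<open>The labels are fixed here. Failure needs a singular class, a null event, or a
  misclassified sample. The latter has probability at most 32 \<delta> per sample: the ratio bound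
  16 \<eta> / w with \<eta> = \<delta> D and w = D / 2, where D is the distance of the true
  vectors.\<close>

lemma prob_em_recovers_ge:
  fixes k n :: nat
  assumes \<beta>: "\<beta>1s \<in> Rvec k" "\<beta>2s \<in> Rvec k" "\<beta>1s \<noteq> \<beta>2s"
    and \<delta>: "0 < \<delta>" "\<delta> \<le> 1 / 2"
    and close: "vdist k \<beta>1 \<beta>1s \<le> \<delta> * vdist k \<beta>1s \<beta>2s" "vdist k \<beta>2 \<beta>2s \<le> \<delta> * vdist k \<beta>1s \<beta>2s"
    and card: "k \<le> card {i\<in>{..<n}. z i}" "k \<le> card {i\<in>{..<n}. \<not> z i}"
  defines "M \<equiv> PiM {..<n} (\<lambda>_. std_gaussian k)"
  shows "1 - real n * (32 * \<delta>) \<le> measure M {x \<in> space M. em_recovers k n \<beta>1s \<beta>2s \<beta>1 \<beta>2 z x}"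
proof -
  interpret M: prob_space M unfolding M_def by (rule prob_space_gaussian_sample)
  let ?D = "vdist k \<beta>1s \<beta>2s"
  have D: "0 < ?D" using vdist_eq_0_iff[OF \<beta>(1,2)] \<beta>(3) vdist_nonneg[of k \<beta>1s \<beta>2s] by linarith
  define u where "u i = (if z i then (\<lambda>j. \<beta>1s j - \<beta>1 j) else (\<lambda>j. \<beta>2s j - \<beta>2 j))" for i
  define v where "v i = (if z i then (\<lambda>j. \<beta>1s j - \<beta>2 j) else (\<lambda>j. \<beta>2s j - \<beta>1 j))" for i
  have "\<delta> * ?D \<le> 1 / 2 * ?D" using \<delta> D by (intro mult_right_mono) auto
  then have half: "\<delta> * ?D \<le> ?D / 2" by simp
  have u: "L2_set (u i) {..<k} \<le> \<delta> * ?D" for i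
    using close by (simp add: u_def vdist_def[symmetric] vdist_commute)
  \<comment> \<open>The other iterate is within D / 2 of the other true vector, so the triangle
    inequality leaves at least D / 2.\<close>
  have v: "?D / 2 \<le> L2_set (v i) {..<k}" for i
    using close half vdist_triangle[of k \<beta>1s \<beta>2s \<beta>2] vdist_triangle[of k \<beta>1s \<beta>2s \<beta>1]
      vdist_commute[of k \<beta>2s \<beta>1] vdist_commute[of k \<beta>1s \<beta>1]
    by (simp add: v_def vdist_def[symmetric])
  let ?Bad = "\<lambda>i. {x \<in> space M. \<bar>ip k (x i) (v i)\<bar> \<le> \<bar>ip k (x i) (u i)\<bar>}"
  let ?G = "{x \<in> space M. em_recovers k n \<beta>1s \<beta>2s \<beta>1 \<beta>2 z x}"
  have Bad: "emeasure M (?Bad i) \<le> ennreal (32 * \<delta>)" if "i < n" for i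
  proof -
    have "emeasure M (?Bad i) \<le> ennreal (16 * (\<delta> * ?D / (?D / 2)))"
      unfolding M_def using \<delta> D that u v by (intro emeasure_gaussian_sample_ratio_le) auto
    also have "16 * (\<delta> * ?D / (?D / 2)) = 32 * \<delta>" using D by (simp add: field_simps)
    finally show ?thesis .
  qed
  have sets_Bad: "?Bad i \<in> sets M" if "i < n" for i
  proof -
    note [measurable] = borel_measurable_ip_sample[OF that, of k, folded M_def]
    show ?thesis by measurable
  qed
  have G: "?G \<in> sets M" unfolding M_def by (intro predE pred_em_recovers \<beta>)
  have "AE x in M. nonsingular k {i\<in>{..<n}. z i} x" "AE x in M. nonsingular k {i\<in>{..<n}. \<not> z i} x"
    unfolding M_def using card by (auto intro!: AE_nonsingular)
  \<comment> \<open>The inclusion holds only almost everywhere, outside the singular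
    designs.\<close>
  then have "AE x in M. x \<in> space M - ?G \<longrightarrow> x \<in> (\<Union>i<n. ?Bad i)"
  proof eventually_elim
    case (elim x)
    show ?case
    proof (intro impI, rule ccontr)
      assume x: "x \<in> space M - ?G" and nb: "x \<notin> (\<Union>i<n. ?Bad i)"
      have lt: "\<bar>ip k (x i) (u i)\<bar> < \<bar>ip k (x i) (v i)\<bar>" if "i < n" for i
        using nb x that by (auto simp: not_le)
      have "em_recovers k n \<beta>1s \<beta>2s \<beta>1 \<beta>2 z x"
      proof (rule em_recovers_if_classified[OF \<beta>(1,2) _ _ elim])
        show "\<bar>ip k (x i) (\<lambda>j. \<beta>1s j - \<beta>1 j)\<bar> < \<bar>ip k (x i) (\<lambda>j. \<beta>1s j - \<beta>2 j)\<bar>" if "i < n" "z i" for i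
          using lt[OF that(1)] that(2) by (simp add: u_def v_def)
        show "\<bar>ip k (x i) (\<lambda>j. \<beta>2s j - \<beta>2 j)\<bar> < \<bar>ip k (x i) (\<lambda>j. \<beta>2s j - \<beta>1 j)\<bar>" if "i < n" "\<not> z i" for i
          using lt[OF that(1)] that(2) by (simp add: u_def v_def)
      qed
      with x show False by simp
    qed
  qed
  then have "emeasure M (space M - ?G) \<le> emeasure M (\<Union>i<n. ?Bad i)"
    using sets_Bad by (intro emeasure_mono_AE sets.finite_UN) auto
  also have "\<dots> \<le> (\<Sum>i<n. emeasure M (?Bad i))"
    using sets_Bad by (intro emeasure_subadditive_finite) auto
  also have "\<dots> \<le> (\<Sum>i<n. ennreal (32 * \<delta>))"
    using Bad by (intro sum_mono) auto
  also have "\<dots> = ennreal (real n * (32 * \<delta>))"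
    using \<delta> by (simp add: ennreal_mult ennreal_of_nat_eq_real_of_nat)
  finally have "measure M (space M - ?G) \<le> real n * (32 * \<delta>)"
    using \<delta> by (simp add: M.emeasure_eq_measure)
  then show ?thesis using M.prob_compl[OF G] by simp
qed

text \<open>Fubini over the labels: by independence the covariates have the same law for every
  labelling, so a bound uniform over the support of \<open>Q\<close> survives averaging.\<close>

lemma measure_sample_law_ge:
  assumes E: "E \<in> sets (sample_law Q k n)"
    and sec: "\<And>z. z \<in> set_pmf Q \<Longrightarrow> c \<le> measure (PiM {..<n} (\<lambda>_. std_gaussian k)) (Pair z -` E)"
  shows "c \<le> measure (sample_law Q k n) E"
proof -
  let ?M = "PiM {..<n} (\<lambda>_. std_gaussian k)"
  interpret M: prob_space ?M by (rule prob_space_gaussian_sample)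
  interpret P: pair_prob_space "measure_pmf Q" ?M ..
  have E': "E \<in> sets (measure_pmf Q \<Otimes>\<^sub>M ?M)" using E by (simp add: sample_law_def)
  have "ennreal c = (\<integral>\<^sup>+z. ennreal c \<partial>measure_pmf Q)" by simp
  also have "\<dots> \<le> (\<integral>\<^sup>+z. emeasure ?M (Pair z -` E) \<partial>measure_pmf Q)"
    using sec by (intro nn_integral_mono_AE) (auto simp: AE_measure_pmf_iff M.emeasure_eq_measure ennreal_leI)
  also have "\<dots> = emeasure (measure_pmf Q \<Otimes>\<^sub>M ?M) E"
    by (rule M.emeasure_pair_measure_alt[OF E', symmetric])
  finally show ?thesis
    unfolding sample_law_def by (simp add: P.emeasure_eq_measure)
qed

text \<open>The clause \<open>2 < c2\<close> rules out a vacuous reading: \<open>min p1 p2\<close>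
  is at most 1/2, so the lower bound on \<open>n\<close> forces n > 2 k, which c2 \<le> 2 would
  contradict.\<close>

theorem proposition4:
  "\<exists>c1 c2 :: real. 0 < c1 \<and> 2 < c2 \<and>
    (\<forall>(k :: nat) (n :: nat) (p1 :: real) (p2 :: real) (Q :: (nat \<Rightarrow> bool) pmf).
     \<forall>\<beta>1s \<in> Rvec k. \<forall>\<beta>2s \<in> Rvec k. \<forall>\<beta>1 \<in> Rvec k. \<forall>\<beta>2 \<in> Rvec k.
       \<beta>1s \<noteq> \<beta>2s \<longrightarrow> L2_set \<beta>1s {..<k} = 1 \<longrightarrow> L2_set \<beta>2s {..<k} = 1 \<longrightarrow>
       0 < p1 \<longrightarrow> 0 < p2 \<longrightarrow> p1 + p2 = 1 \<longrightarrow>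
       (\<forall>z \<in> set_pmf Q. real (card {i \<in> {..<n}. z i}) = p1 * real n \<and>
                        real (card {i \<in> {..<n}. \<not> z i}) = p2 * real n) \<longrightarrow>
       max (vdist k \<beta>1 \<beta>1s) (vdist k \<beta>2 \<beta>2s) \<le> c1 / (real k)\<^sup>2 * vdist k \<beta>1s \<beta>2s \<longrightarrow>
       1 / min p1 p2 * real k < real n \<longrightarrow> real n < c2 * real k \<longrightarrow>
       measure (sample_law Q k n)
         {(z, x) \<in> space (sample_law Q k n).
            \<forall>\<beta>1p \<beta>2p. em_output k n (response k \<beta>1s \<beta>2s z x) x \<beta>1 \<beta>2 \<beta>1p \<beta>2p \<longrightarrow>
              max (vdist k \<beta>1p \<beta>1s) (vdist k \<beta>2p \<beta>2s) = 0}
         > 1 - 1 / real k)"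
\<comment> \<open>With \<delta> = 1 / (200 k^2) and n < 3 k, the union bound n (32 \<delta>) is at
  most (96 / 200) / k, below 1 / k.\<close>
proof (rule exI[of _ "1/200"], rule exI[of _ 3], intro conjI allI ballI impI)
  fix k n :: nat and p1 p2 :: real and Q :: "(nat \<Rightarrow> bool) pmf" and \<beta>1s \<beta>2s \<beta>1 \<beta>2
  assume \<beta>: "\<beta>1s \<in> Rvec k" "\<beta>2s \<in> Rvec k" and ne: "\<beta>1s \<noteq> \<beta>2s"
    and norm: "L2_set \<beta>1s {..<k} = 1" and p: "0 < p1" "0 < p2"
    and cards: "\<forall>z \<in> set_pmf Q. real (card {i \<in> {..<n}. z i}) = p1 * real n \<and>
                        real (card {i \<in> {..<n}. \<not> z i}) = p2 * real n"
    and close: "max (vdist k \<beta>1 \<beta>1s) (vdist k \<beta>2 \<beta>2s) \<le> 1/200 / (real k)\<^sup>2 * vdist k \<beta>1s \<beta>2s"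
    and n: "1 / min p1 p2 * real k < real n" "real n < 3 * real k"
  let ?M = "PiM {..<n} (\<lambda>_. std_gaussian k)"
  let ?E = "{(z, x) \<in> space (sample_law Q k n). em_recovers k n \<beta>1s \<beta>2s \<beta>1 \<beta>2 z x}"
  \<comment> \<open>In dimension 0 no vector has norm 1.\<close>
  have k: "0 < k" using norm by (cases k) auto
  define \<delta> where "\<delta> = 1/200 / (real k)\<^sup>2"
  have "1 \<le> (real k)\<^sup>2" using k by (simp add: one_le_power)
  then have "\<delta> \<le> (1/200) / 1" unfolding \<delta>_def using k by (intro divide_left_mono) auto
  moreover have "0 < \<delta>" unfolding \<delta>_def using k by simp
  ultimately have \<delta>: "0 < \<delta>" "\<delta> \<le> 1/2" by simp_all
  \<comment> \<open>The lower bound on \<open>n\<close> says precisely that the smaller class has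
    more than \<open>k\<close> samples, enough to span.\<close>
  have kn: "real k < min p1 p2 * real n" using n(1) p by (simp add: field_simps)
  have sec: "1 - real n * (32 * \<delta>) \<le> measure ?M (Pair z -` ?E)" if z: "z \<in> set_pmf Q" for z
  proof -
    have min: "min p1 p2 * real n \<le> p1 * real n" "min p1 p2 * real n \<le> p2 * real n"
      by (intro mult_right_mono; simp)+
    have card: "real (card {i\<in>{..<n}. z i}) = p1 * real n" "real (card {i\<in>{..<n}. \<not> z i}) = p2 * real n"
      using cards z by blast+
    have card1: "k \<le> card {i\<in>{..<n}. z i}"
      using kn min(1) card(1) by (intro of_nat_le_iff[where 'a = real, THEN iffD1]) linarith
    have card2: "k \<le> card {i\<in>{..<n}. \<not> z i}"
      using kn min(2) card(2) by (intro of_nat_le_iff[where 'a = real, THEN iffD1]) linarith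
    have "vdist k \<beta>1 \<beta>1s \<le> \<delta> * vdist k \<beta>1s \<beta>2s" "vdist k \<beta>2 \<beta>2s \<le> \<delta> * vdist k \<beta>1s \<beta>2s"
      using close unfolding \<delta>_def[symmetric] by linarith+
    then have "1 - real n * (32 * \<delta>) \<le> measure ?M {x \<in> space ?M. em_recovers k n \<beta>1s \<beta>2s \<beta>1 \<beta>2 z x}"
      by (rule prob_em_recovers_ge[OF \<beta> ne \<delta> _ _ card1 card2])
    also have "{x \<in> space ?M. em_recovers k n \<beta>1s \<beta>2s \<beta>1 \<beta>2 z x} = Pair z -` ?E"
      unfolding vimage_def by (simp add: sample_law_def space_pair_measure)
    finally show ?thesis .
  qed
  have "real n * (32 * \<delta>) \<le> 3 * real k * (32 * \<delta>)"
    using n(2) \<delta> by (intro mult_right_mono) auto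
  also have "\<dots> = (96/200) * (1 / real k)"
    using k by (simp add: \<delta>_def power2_eq_square)
  also have "\<dots> < 1 / real k" using k by (simp add: field_simps)
  finally have "1 - 1 / real k < 1 - real n * (32 * \<delta>)" by simp
  also have "\<dots> \<le> measure (sample_law Q k n) ?E"
    by (rule measure_sample_law_ge[OF sets_em_recovers[OF \<beta>] sec])
  finally show "1 - 1 / real k < measure (sample_law Q k n)
         {(z, x) \<in> space (sample_law Q k n).
            \<forall>\<beta>1p \<beta>2p. em_output k n (response k \<beta>1s \<beta>2s z x) x \<beta>1 \<beta>2 \<beta>1p \<beta>2p \<longrightarrow>
              max (vdist k \<beta>1p \<beta>1s) (vdist k \<beta>2p \<beta>2s) = 0}"
    unfolding em_recovers_def .
qed auto

end
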